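(* Let $K$ be a field, let $S=K[x_1,\ldots,x_n]$, and let $M=(m_1,\ldots,m_q)$, with $q\geq 1$, be a squarefree monomial ideal of $S$ generated by monomials $m_1,\ldots,m_q$. Let $k\geq 0$ be an integer such that $\deg(m_i)>k$ for all $i=1,\ldots,q$. Then $\operatorname{pd}(S/M)\leq n-k$.
   Context: A squarefree monomial ideal is an ideal generated by squarefree monomials; $\deg$ denotes the total degree of a monomial. The projective dimension is $\operatorname{pd}(S/M)=\max\{i : b_i(S/M)\neq 0\}$, where $b_i(S/M)=\operatorname{rank}(F_i)$ and $\cdots\to F_i\to F_{i-1}\to\cdots\to F_0\to S/M\to 0$ is a minimal (multigraded) free resolution of $S/M$ over $S$, that is, one in which no differential matrix has an invertible entry. *)

theory Defs
  imports "HOL-Library.Poly_Mapping" "HOL-Library.Extended_Nat" "HOL-Library.Set_Algebras"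
    "HOL-Library.Cardinality"
    "Jordan_Normal_Form.Matrix_Kernel"
begin

text \<open>
  The polynomial ring \<open>S = K[x\<^sub>1,\<dots>,x\<^sub>n]\<close> is the convolution algebra of finitely supported functions
  from exponent vectors to \<open>K\<close>; the variables are indexed by the finite type \<open>'n\<close>, so \<open>n = CARD('n)\<close>.
\<close>

type_synonym 'n expvec = "'n \<Rightarrow>\<^sub>0 nat"
type_synonym ('n, 'a) mpoly = "'n expvec \<Rightarrow>\<^sub>0 'a"

definition monomial :: "'n expvec \<Rightarrow> ('n, 'a::zero_neq_one) mpoly" where
  "monomial e = Poly_Mapping.single e 1"

definition total_degree :: "'n::finite expvec \<Rightarrow> nat" where
  "total_degree e = (\<Sum>j\<in>UNIV. Poly_Mapping.lookup e j)"

definition squarefree_expvec :: "'n expvec \<Rightarrow> bool" where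
  "squarefree_expvec e \<longleftrightarrow> (\<forall>j. Poly_Mapping.lookup e j \<le> 1)"

definition ideal_of :: "'r::comm_ring_1 set \<Rightarrow> 'r set" where
  "ideal_of B = Modules.module.span (*) B"

definition squarefree_monomial_ideal :: "('n, 'a::field) mpoly set \<Rightarrow> bool" where
  "squarefree_monomial_ideal M \<longleftrightarrow> (\<exists>E. (\<forall>e\<in>E. squarefree_expvec e) \<and> M = ideal_of (monomial ` E))"

text \<open>
  An augmented complex \<open>\<cdots> \<rightarrow> F\<^sub>1 \<rightarrow> F\<^sub>0 \<rightarrow> S/M\<close> of finitely generated multigraded free modules.
  The module \<open>F\<^sub>i\<close> is \<open>S\<^bsup>r\<^esup>\<close>, \<open>r = length (degs F i)\<close>, and its \<open>j\<close>-th basis vector has multidegree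
  \<open>degs F i ! j\<close>. The matrix of the differential \<open>F\<^sub>i\<^sub>+\<^sub>1 \<rightarrow> F\<^sub>i\<close> is \<open>diff F i\<close>. Since \<open>F\<^sub>0\<close> is free, an
  \<open>S\<close>-linear map \<open>F\<^sub>0 \<rightarrow> S/M\<close> is given by representatives in \<open>S\<close> of the images of the basis
  vectors; these form the vector \<open>aug F\<close>.
\<close>

record (overloaded) ('n, 'a) aug_complex =
  degs :: "nat \<Rightarrow> 'n expvec list"
  diff :: "nat \<Rightarrow> ('n, 'a) mpoly mat"
  aug :: "('n, 'a) mpoly vec"

definition free_rank :: "('n, 'a) aug_complex \<Rightarrow> nat \<Rightarrow> nat" where
  "free_rank F i = length (degs F i)"

definition free_mod :: "('n, 'a) aug_complex \<Rightarrow> nat \<Rightarrow> ('n, 'a) mpoly vec set" where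
  "free_mod F i = carrier_vec (free_rank F i)"

text \<open>Zero counts as homogeneous of every degree.\<close>

definition homogeneous_shift :: "'n expvec \<Rightarrow> 'n expvec \<Rightarrow> ('n, 'a::zero) mpoly \<Rightarrow> bool" where
  "homogeneous_shift a b p \<longleftrightarrow> (\<forall>e\<in>Poly_Mapping.keys p. e + a = b)"

text \<open>All maps are \<open>S\<close>-linear and preserve multidegrees.\<close>

definition multigraded :: "('n, 'a::field) aug_complex \<Rightarrow> bool" where
  "multigraded F \<longleftrightarrow>
     (\<forall>i. diff F i \<in> carrier_mat (free_rank F i) (free_rank F (Suc i)) \<and>
        (\<forall>r<free_rank F i. \<forall>c<free_rank F (Suc i).
           homogeneous_shift (degs F i ! r) (degs F (Suc i) ! c) (diff F i $$ (r, c)))) \<and>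
     aug F \<in> free_mod F 0 \<and>
     (\<forall>c<free_rank F 0. homogeneous_shift 0 (degs F 0 ! c) (aug F $ c))"

definition quotient_ring :: "('n, 'a::field) mpoly set \<Rightarrow> ('n, 'a) mpoly set set" where
  "quotient_ring M = range (\<lambda>f. f +o M)"

definition aug_map :: "('n, 'a::field) mpoly set \<Rightarrow> ('n, 'a) aug_complex \<Rightarrow>
    ('n, 'a) mpoly vec \<Rightarrow> ('n, 'a) mpoly set" where
  "aug_map M F v = (aug F \<bullet> v) +o M"

definition diff_image :: "('n, 'a::field) aug_complex \<Rightarrow> nat \<Rightarrow> ('n, 'a) mpoly vec set" where
  "diff_image F i = (\<lambda>w. diff F i *\<^sub>v w) ` free_mod F (Suc i)"

definition free_resolution :: "('n, 'a::field) mpoly set \<Rightarrow> ('n, 'a) aug_complex \<Rightarrow> bool" where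
  "free_resolution M F \<longleftrightarrow>
     multigraded F \<and>
     aug_map M F ` free_mod F 0 = quotient_ring M \<and>
     {v \<in> free_mod F 0. aug_map M F v = 0 +o M} = diff_image F 0 \<and>
     (\<forall>i. mat_kernel (diff F i) = diff_image F (Suc i))"

definition minimal_free_resolution :: "('n, 'a::field) mpoly set \<Rightarrow> ('n, 'a) aug_complex \<Rightarrow> bool" where
  "minimal_free_resolution M F \<longleftrightarrow>
     free_resolution M F \<and>
     (\<forall>i. \<forall>r<free_rank F i. \<forall>c<free_rank F (Suc i). \<not> diff F i $$ (r, c) dvd 1)"

text \<open>
  Minimal multigraded free resolutions exist for monomial ideals and are unique up to isomorphism,
  so the ranks below do not depend on the choice.
\<close>

definition betti :: "('n, 'a::field) mpoly set \<Rightarrow> nat \<Rightarrow> nat" where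
  "betti M i = free_rank (SOME F. minimal_free_resolution M F) i"

text \<open>
  The projective dimension of \<open>S/M\<close>, as a supremum in the extended naturals: it is the maximum when
  only finitely many Betti numbers are nonzero, and infinite otherwise.
\<close>

definition proj_dim :: "('n, 'a::field) mpoly set \<Rightarrow> enat" where
  "proj_dim M = Sup (enat ` {i. betti M i \<noteq> 0})"

end

theory Submission
  imports Defs
begin

text \<open>
  Since \<open>b\<^sub>i\<close> is defined through an arbitrary choice of minimal resolution, both existence and
  the bound on ranks are needed. Existence: the kernel of a multigraded matrix with squarefree column
  degrees is generated in squarefree degrees, hence finitely generated, and a generating family with
  fewest members is minimal. Bound: in a minimal resolution \<open>b\<^sub>i = 0\<close> as soon as the Koszul homology
  \<open>H\<^sub>i(x; S/M)\<close> vanishes, by dimension shifting along the resolution. For \<open>i > n - k\<close> it vanishes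
  because the multigraded contracting homotopy of the Koszul complex of \<open>S\<close> maps \<open>M\<close>-chains to
  \<open>M\<close>-chains: in a squarefree multidegree the monomial coefficient of an \<open>(i-1)\<close>-chain has degree
  at most \<open>n - (i - 1) \<le> k\<close> and so does not lie in \<open>M\<close>.
\<close>

section \<open>Polynomials as finitely supported functions\<close>

text \<open>Neither Tor nor homology modules are formed: exactness is stated by witnesses, for
  Koszul chains with coefficients in F_q modulo a kernel, which turns the dimension shift into a
  diagram chase. The obstacle is the homotopy. An Euler-type homotopy divides by degrees and fails
  in positive characteristic; moving one variable into the exterior part, chosen separately in each
  multidegree, needs only signs. The price is that the homotopy is not S-linear, so it is applied to
  components of chains and never commuted with a matrix. The choice must also respect M. Dividing a
  coefficient by x_j is harmless if x_j still divides the result, because M is squarefree; this is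
  arranged whenever the multidegree has an exponent of at least two. The degree bound is left to
  settle the squarefree multidegrees.\<close>

abbreviation "lookup \<equiv> Poly_Mapping.lookup"
abbreviation "keys \<equiv> Poly_Mapping.keys"

lemma lookup_single_times:
  fixes p :: "'a::cancel_comm_monoid_add \<Rightarrow>\<^sub>0 'b::semiring_0"
  shows "lookup (Poly_Mapping.single t c * p) (t + u) = c * lookup p u"
proof (induction p rule: update_induct)
  case const
  then show ?case by simp
next
  case (update f a b)
  have "Poly_Mapping.update a b f = f + Poly_Mapping.single a b"
    using update by (intro poly_mapping_eqI)
      (auto simp: lookup_update lookup_add lookup_single when_def in_keys_iff)
  then show ?case
    using update.IH
    by (simp add: distrib_left lookup_add mult_single lookup_single when_def)
qed

lemma lookup_single_times_eq_0:
  fixes p :: "'a::cancel_comm_monoid_add \<Rightarrow>\<^sub>0 'b::semiring_0"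
  assumes "\<And>v. u \<noteq> t + v"
  shows "lookup (Poly_Mapping.single t c * p) u = 0"
proof (rule ccontr)
  assume "lookup (Poly_Mapping.single t c * p) u \<noteq> 0"
  then have "u \<in> keys (Poly_Mapping.single t c * p)" by (simp add: in_keys_iff)
  then show False using keys_mult[of "Poly_Mapping.single t c" p] assms
    by (auto split: if_splits)
qed

lemma poly_mapping_sum_single:
  "p = (\<Sum>e\<in>keys p. Poly_Mapping.single e (lookup p e))"
  by (intro poly_mapping_eqI)
    (auto simp: lookup_sum lookup_single when_def in_keys_iff sum.delta[OF finite_keys])

text \<open>Divisibility of monomials. Subtraction of exponent vectors truncates at zero, so
  \<open>b - a\<close> is the exponent of a quotient only under this relation.\<close>

definition exp_le :: "'n expvec \<Rightarrow> 'n expvec \<Rightarrow> bool" (infix \<open>\<preceq>\<close> 50) where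
  "a \<preceq> b \<longleftrightarrow> (\<forall>j. lookup a j \<le> lookup b j)"

lemma exp_le_iff: "a \<preceq> b \<longleftrightarrow> (\<exists>d. b = a + d)"
proof
  assume "a \<preceq> b"
  then have "b = a + (b - a)"
    by (intro poly_mapping_eqI) (simp add: lookup_add lookup_minus exp_le_def)
  then show "\<exists>d. b = a + d" ..
qed (auto simp: exp_le_def lookup_add)

lemma exp_le_add_diff: "a \<preceq> b \<Longrightarrow> a + (b - a) = b"
  by (intro poly_mapping_eqI) (simp add: lookup_add lookup_minus exp_le_def)

text \<open>Plays two roles: the multidegree of the exterior basis element e_T and, as
  \<open>ind (keys b)\<close>, the radical of the monomial with exponent \<open>b\<close>.\<close>

definition ind :: "'n::finite set \<Rightarrow> 'n expvec" where
  "ind T = Abs_poly_mapping (\<lambda>j. of_bool (j \<in> T))"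

lemma lookup_ind [simp]: "lookup (ind T) j = of_bool (j \<in> T)"
  by (simp add: ind_def)

text \<open>Exponent vectors with sum zero are both zero, so a single product contributes. The
  constant coefficient is thus the reduction S -> K modulo the variables.\<close>

lemma lookup_0_times:
  fixes p q :: "('n, 'a::field) mpoly"
  shows "lookup (p * q) 0 = lookup p 0 * lookup q 0"
proof -
  have "lookup (p * q) 0 = (\<Sum>e\<in>keys p. lookup (Poly_Mapping.single e (lookup p e) * q) 0)"
    by (subst poly_mapping_sum_single[of p]) (simp add: sum_distrib_right lookup_sum)
  also have "\<dots> = (\<Sum>e\<in>keys p. if e = 0 then lookup p 0 * lookup q 0 else 0)"
  proof (intro sum.cong refl)
    fix e
    show "lookup (Poly_Mapping.single e (lookup p e) * q) 0 = (if e = 0 then lookup p 0 * lookup q 0 else 0)"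
    proof (cases "e = 0")
      case True
      then show ?thesis using lookup_single_times[of 0 "lookup p 0" q 0] by simp
    next
      case False
      have "0 \<noteq> e + v" for v
      proof
        assume *: "0 = e + v"
        have "lookup e j = 0" for j using arg_cong[OF *, of "\<lambda>x. lookup x j"] by (simp add: lookup_add)
        with False show False by (auto intro: poly_mapping_eqI)
      qed
      then show ?thesis using False by (simp add: lookup_single_times_eq_0)
    qed
  qed
  also have "\<dots> = lookup p 0 * lookup q 0"
    by (auto simp: in_keys_iff sum.delta)
  finally show ?thesis .
qed

definition var :: "'n \<Rightarrow> ('n, 'a::field) mpoly" where
  "var j = Poly_Mapping.single (Poly_Mapping.single j 1) 1"

lemma lookup_var_times:
  "lookup (var j * p) u = (if lookup u j = 0 then 0 else lookup p (u - Poly_Mapping.single j 1))"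
proof (cases "lookup u j = 0")
  case True
  then have "u \<noteq> Poly_Mapping.single j 1 + v" for v by (auto simp: lookup_add)
  then show ?thesis using True unfolding var_def by (simp add: lookup_single_times_eq_0)
next
  case False
  then have "Poly_Mapping.single j 1 \<preceq> u" by (auto simp: exp_le_def lookup_single when_def)
  from exp_le_add_diff[OF this] show ?thesis using False
    lookup_single_times[of "Poly_Mapping.single j 1" 1 p "u - Poly_Mapping.single j 1"]
    by (simp add: var_def)
qed

section \<open>The Koszul complex\<close>

text \<open>The index type carries no order; an arbitrary injection into \<open>nat\<close> orients
  the exterior basis.\<close>

definition var_rank :: "'n::finite \<Rightarrow> nat" where
  "var_rank = (SOME f. inj f)"

lemma inj_var_rank: "inj (var_rank :: 'n::finite \<Rightarrow> nat)"
proof -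
  obtain f :: "'n \<Rightarrow> nat" where "inj f"
    using finite_imp_inj_to_nat_seg[OF finite] by meson
  then show ?thesis unfolding var_rank_def by (rule someI[of inj])
qed

text \<open>For j outside T, the sign by which e_j wedge e_T differs from the basis element of
  \<open>insert j T\<close>.\<close>

definition sg :: "'n::finite \<Rightarrow> 'n set \<Rightarrow> 'b::comm_ring_1" where
  "sg j T = (-1) ^ card {i \<in> T. var_rank i < var_rank j}"

lemma sg_square: "sg j T * sg j T = 1"
  by (simp add: sg_def flip: power_mult_distrib)

lemma sg_insert:
  assumes "i \<notin> T"
  shows "sg j (insert i T) = (if var_rank i < var_rank j then - sg j T else sg j T)"
proof -
  have "{l \<in> insert i T. var_rank l < var_rank j} = (if var_rank i < var_rank j
     then insert i {l \<in> T. var_rank l < var_rank j} else {l \<in> T. var_rank l < var_rank j})"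
    by auto
  then show ?thesis using assms by (auto simp: sg_def)
qed

lemma sg_anticomm:
  assumes "i \<notin> T" "j \<notin> T" "i \<noteq> j"
  shows "sg i T * sg j (insert i T) = - (sg j T * sg i (insert j T))"
proof -
  have "var_rank i < var_rank j \<or> var_rank j < var_rank i"
    using inj_var_rank assms(3) by (metis injD linorder_neqE_nat)
  then show ?thesis using assms by (auto simp: sg_insert)
qed

text \<open>Of the two insertions exactly one moves past the other index. In this mixed form the
  rule cancels the terms away from the pivot in the homotopy identity.\<close>

lemma sg_anticomm':
  assumes "i \<notin> T" "j \<notin> T" "i \<noteq> j"
  shows "sg i (insert j T) * sg j (insert i T) = - (sg j T * sg i T)"
proof -
  have "var_rank i < var_rank j \<or> var_rank j < var_rank i"
    using inj_var_rank assms(3) by (metis injD linorder_neqE_nat)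
  then show ?thesis using assms by (auto simp: sg_insert)
qed

lemma lookup_sg_times: "lookup (sg j T * p) u = sg j T * lookup (p :: ('n, 'a::field) mpoly) u"
  unfolding sg_def by (cases "even (card {i \<in> T. var_rank i < var_rank j})") auto

text \<open>The chain \<open>f\<close> of the Koszul complex stands for \<open>\<Sum>T. f T \<cdot> e\<^sub>T\<close>, with all Koszul degrees \<open>card T\<close> at once.\<close>

definition koszul :: "('n::finite set \<Rightarrow> ('n, 'a::field) mpoly) \<Rightarrow> 'n set \<Rightarrow> ('n, 'a) mpoly" where
  "koszul f T = (\<Sum>j\<in>-T. sg j T * (var j * f (insert j T)))"

lemma koszul_cong:
  assumes "\<And>T'. card T' = Suc (card T) \<Longrightarrow> f T' = g T'"
  shows "koszul f T = koszul g T"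
  unfolding koszul_def using assms by (intro sum.cong refl) auto

lemma koszul_diff: "koszul (\<lambda>T. f T - g T) T = koszul f T - koszul g T"
  by (simp add: koszul_def algebra_simps sum_subtractf)

text \<open>By S-linearity the Koszul differential commutes with the matrices of a resolution; the
  chases in the resulting double complex rest on this.\<close>

lemma koszul_sum_mult: "koszul (\<lambda>T. \<Sum>c\<in>C. d c * f T c) T = (\<Sum>c\<in>C. d c * koszul (\<lambda>T. f T c) T)"
  unfolding koszul_def by (simp add: sum_distrib_left sum.swap[of _ C] algebra_simps)

lemma lookup_koszul_0 [simp]: "lookup (koszul f T) 0 = 0"
  by (simp add: koszul_def lookup_sum lookup_sg_times lookup_var_times)

text \<open>Comparing ranks splits the pairs into two halves that cancel under exchange of the
  indices. Concluding from twice the sum being zero would fail in characteristic two.\<close>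

lemma sum_antisym_pairs:
  fixes a :: "'i \<Rightarrow> 'i \<Rightarrow> 'b::ab_group_add" and r :: "'i \<Rightarrow> nat"
  assumes "finite A" "inj r" "\<And>i j. i \<in> A \<Longrightarrow> j \<in> A \<Longrightarrow> i \<noteq> j \<Longrightarrow> a i j = - a j i"
  shows "(\<Sum>i\<in>A. \<Sum>j\<in>A - {i}. a i j) = 0"
proof -
  have eq: "A - {i} = {j \<in> A. r i < r j} \<union> {j \<in> A. r j < r i}" for i
    using assms(2) by (auto dest: injD) (metis injD linorder_neqE_nat)
  have "(\<Sum>i\<in>A. \<Sum>j\<in>A - {i}. a i j)
     = (\<Sum>i\<in>A. \<Sum>j\<in>{j \<in> A. r i < r j}. a i j) + (\<Sum>i\<in>A. \<Sum>j\<in>{j \<in> A. r j < r i}. a i j)"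
    unfolding eq sum.distrib[symmetric] using assms(1)
    by (intro sum.cong refl sum.union_disjoint) auto
  also have "(\<Sum>i\<in>A. \<Sum>j\<in>{j \<in> A. r j < r i}. a i j) = (\<Sum>j\<in>A. \<Sum>i\<in>{i \<in> A. r j < r i}. a i j)"
    using sum.swap_restrict[OF assms(1) assms(1), of a "\<lambda>i j. r j < r i"] by simp
  also have "\<dots> = (\<Sum>j\<in>A. \<Sum>i\<in>{i \<in> A. r j < r i}. - a j i)"
    using assms(3) by (intro sum.cong refl) auto
  finally show ?thesis by (simp add: sum_negf)
qed

lemma koszul_koszul [simp]: "koszul (koszul f) T = 0"
proof -
  define a where "a i j = sg i T * (sg j (insert i T) * (var i * (var j * f (insert j (insert i T)))))" for i j
  have "koszul (koszul f) T = (\<Sum>i\<in>-T. \<Sum>j\<in>- insert i T. a i j)"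
    by (simp add: koszul_def a_def sum_distrib_left algebra_simps)
  also have "\<dots> = (\<Sum>i\<in>-T. \<Sum>j\<in>-T - {i}. a i j)"
    by (intro sum.cong refl) auto
  also have "\<dots> = 0"
  proof (rule sum_antisym_pairs[OF _ inj_var_rank])
    fix i j assume "i \<in> -T" "j \<in> -T" "i \<noteq> j"
    then have "sg i T * sg j (insert i T) = - (sg j T * sg i (insert j T) :: ('a, 'b) mpoly)"
      using sg_anticomm by auto
    from arg_cong[OF this, of "\<lambda>x. x * (var i * (var j * f (insert j (insert i T))))"]
    show "a i j = - a j i"
      by (simp add: a_def algebra_simps insert_commute)
  qed simp
  finally show ?thesis .
qed

text \<open>
  Contracting homotopy. In multidegree \<open>b\<close> it adds the variable \<open>pivot b\<close> to the exterior part;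
  the preference for an exponent \<open>\<ge> 2\<close> is what makes it respect squarefree ideals.
\<close>

definition pivot :: "'n::finite expvec \<Rightarrow> 'n" where
  "pivot b = (if \<exists>j. lookup b j \<ge> 2 then SOME j. lookup b j \<ge> 2 else SOME j. lookup b j \<ge> 1)"

lemma lookup_pivot:
  assumes "b \<noteq> 0"
  shows "lookup b (pivot b) \<ge> 1"
proof -
  obtain j where "lookup b j \<ge> 1" using assms
    by (metis One_nat_def Suc_leI bot_nat_0.not_eq_extremum lookup_zero poly_mapping_eqI)
  then have "lookup b (SOME j. lookup b j \<ge> 1) \<ge> 1" by (rule someI)
  moreover have "lookup b (SOME j. lookup b j \<ge> 2) \<ge> 2" if "\<exists>j. lookup b j \<ge> 2"
    using that by (rule someI_ex)
  ultimately show ?thesis unfolding pivot_def by force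
qed

lemma lookup_pivot_le_1:
  assumes "lookup b (pivot b) \<le> 1"
  shows "lookup b j \<le> 1"
proof (rule ccontr)
  assume "\<not> lookup b j \<le> 1"
  then have ex: "\<exists>j. lookup b j \<ge> 2" by (metis Suc_1 not_less_eq_eq)
  then have "lookup b (SOME j. lookup b j \<ge> 2) \<ge> 2" by (rule someI_ex)
  with ex assms show False by (simp add: pivot_def)
qed

text \<open>The term x^u e_T has multidegree \<open>u + ind T\<close>. If j is the pivot of its
  multidegree, x^v e_S is sent to (x^v / x_j) e_j wedge e_S, which is zero for j in S. The body
  reads off a coefficient of the image, with S = T - {j} and v = u + e_j.\<close>

definition htpy :: "('n::finite set \<Rightarrow> ('n, 'a::field) mpoly) \<Rightarrow> 'n set \<Rightarrow> ('n, 'a) mpoly" where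
  "htpy f T = Abs_poly_mapping (\<lambda>u. let j = pivot (u + ind T) in
     if j \<in> T then sg j (T - {j}) * lookup (f (T - {j})) (u + Poly_Mapping.single j 1) else 0)"

text \<open>The function given to \<open>Abs_poly_mapping\<close> has finite support: the pivot
  varies with \<open>u\<close> but takes finitely many values, and each value admits only shifted
  keys of one \<open>f (T - {j})\<close>.\<close>

lemma lookup_htpy:
  "lookup (htpy f T) u = (let j = pivot (u + ind T) in
     if j \<in> T then sg j (T - {j}) * lookup (f (T - {j})) (u + Poly_Mapping.single j 1) else 0)"
proof -
  let ?g = "\<lambda>u. let j = pivot (u + ind T) in
     if j \<in> T then sg j (T - {j}) * lookup (f (T - {j})) (u + Poly_Mapping.single j 1) else 0"
  have "{u. ?g u \<noteq> 0} \<subseteq> (\<Union>j\<in>UNIV. (\<lambda>v. v - Poly_Mapping.single j 1) ` keys (f (T - {j})))"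
  proof
    fix u assume "u \<in> {u. ?g u \<noteq> 0}"
    then have "u + Poly_Mapping.single (pivot (u + ind T)) 1 \<in> keys (f (T - {pivot (u + ind T)}))"
      by (auto simp: Let_def in_keys_iff split: if_splits)
    then show "u \<in> (\<Union>j\<in>UNIV. (\<lambda>v. v - Poly_Mapping.single j 1) ` keys (f (T - {j})))"
      by (force intro!: image_eqI[of u])
  qed
  then have "finite {u. ?g u \<noteq> 0}" by (rule finite_subset) auto
  then show ?thesis unfolding htpy_def by (simp add: lookup_Abs_poly_mapping)
qed

lemma htpy_0:
  assumes "\<And>T'. Suc (card T') = card T \<Longrightarrow> f T' = 0"
  shows "htpy f T = 0"
proof (intro poly_mapping_eqI)
  fix u
  have "f (T - {j}) = 0" if "j \<in> T" for j
    using that assms by (metis card_Suc_Diff1 finite)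
  then show "lookup (htpy f T) u = lookup 0 u" by (simp add: lookup_htpy Let_def)
qed

lemma lookup_koszul:
  "lookup (koszul f T) u = (\<Sum>i\<in>-T. if lookup u i = 0 then 0
     else sg i T * lookup (f (insert i T)) (u - Poly_Mapping.single i 1))"
  by (auto simp: koszul_def lookup_sum lookup_sg_times lookup_var_times intro!: sum.cong)

text \<open>Both maps preserve the multidegree \<open>u + ind T\<close>, so one pivot j serves all
  terms. If j is not in T, only the summand i = j of \<open>koszul (htpy f) T\<close> survives. If j
  is in T, the summand i = j of \<open>koszul f (T - {j})\<close> gives \<open>f T\<close> and the
  rest cancels. Multidegree zero has no pivot and is excluded.\<close>

lemma htpy_koszul:
  assumes "u + ind T \<noteq> 0"
  shows "lookup (koszul (htpy f) T) u + lookup (htpy (koszul f) T) u = lookup (f T) u"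
proof -
  define j where "j = pivot (u + ind T)"
  have j: "lookup (u + ind T) j \<ge> 1" using lookup_pivot[OF assms] by (simp add: j_def)
  have h: "lookup (htpy f (insert i T)) (u - Poly_Mapping.single i 1) =
      (if j \<in> insert i T then sg j (insert i T - {j}) *
         lookup (f (insert i T - {j})) (u - Poly_Mapping.single i 1 + Poly_Mapping.single j 1) else 0)"
    if "i \<notin> T" "lookup u i \<noteq> 0" for i
  proof -
    have "u - Poly_Mapping.single i 1 + ind (insert i T) = u + ind T"
      using that by (intro poly_mapping_eqI) (auto simp: lookup_add lookup_minus lookup_single when_def)
    then show ?thesis by (simp add: lookup_htpy j_def Let_def)
  qed
  show ?thesis
  proof (cases "j \<in> T")
    case False
    then have uj: "lookup u j \<noteq> 0" using j by (simp add: lookup_add)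
    then have uj': "u - Poly_Mapping.single j 1 + Poly_Mapping.single j 1 = u"
      by (intro poly_mapping_eqI) (auto simp: lookup_add lookup_minus lookup_single when_def)
    have "lookup (htpy (koszul f) T) u = 0" using False by (simp add: lookup_htpy j_def[symmetric])
    moreover have "lookup (koszul (htpy f) T) u = (\<Sum>i\<in>-T. if i = j then lookup (f T) u else 0)"
      unfolding lookup_koszul
    proof (intro sum.cong refl)
      fix i assume i: "i \<in> - T"
      have "sg j T * (sg j T * x) = x" for x :: 'b
        by (simp add: sg_square flip: mult.assoc)
      then show "(if lookup u i = 0 then 0 else sg i T * lookup (htpy f (insert i T)) (u - Poly_Mapping.single i 1))
         = (if i = j then lookup (f T) u else 0)"
        using h[of i] i False uj uj' by auto
    qed
    ultimately show ?thesis using False by simp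
  next
    case True
    define R where "R = T - {j}"
    have T: "T = insert j R" "j \<notin> R" using True by (auto simp: R_def)
    have split: "- R = insert j (- T)" using T by auto
    have "lookup (htpy (koszul f) T) u = sg j R * lookup (koszul f R) (u + Poly_Mapping.single j 1)"
      using True by (simp add: lookup_htpy j_def[symmetric] R_def)
    also have "\<dots> = lookup (f T) u + (\<Sum>i\<in>-T. if lookup u i = 0 then 0 else
        sg j R * sg i R * lookup (f (insert i R)) (u + Poly_Mapping.single j 1 - Poly_Mapping.single i 1))"
    proof -
      have sq: "sg j R * (sg j R * x) = x" for x :: 'b
        by (simp add: sg_square flip: mult.assoc)
      have "sg j R * lookup (koszul f R) (u + Poly_Mapping.single j 1)
        = lookup (f T) u + (\<Sum>i\<in>-T. sg j R * (if lookup (u + Poly_Mapping.single j 1) i = 0 then 0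
           else sg i R * lookup (f (insert i R)) (u + Poly_Mapping.single j 1 - Poly_Mapping.single i 1)))"
        unfolding lookup_koszul split using T
        by (subst sum.insert) (auto simp: distrib_left sum_distrib_left lookup_add sq)
      also have "\<dots> = lookup (f T) u + (\<Sum>i\<in>-T. if lookup u i = 0 then 0 else
        sg j R * sg i R * lookup (f (insert i R)) (u + Poly_Mapping.single j 1 - Poly_Mapping.single i 1))"
        using T by (intro arg_cong2[of _ _ _ _ "(+)"] sum.cong refl)
          (auto simp: lookup_add lookup_single when_def mult.assoc)
      finally show ?thesis .
    qed
    finally have 1: "lookup (htpy (koszul f) T) u = \<dots>" .
    have "lookup (koszul (htpy f) T) u = - (\<Sum>i\<in>-T. if lookup u i = 0 then 0 else
        sg j R * sg i R * lookup (f (insert i R)) (u + Poly_Mapping.single j 1 - Poly_Mapping.single i 1))"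
      unfolding lookup_koszul sum_negf[symmetric]
    proof (intro sum.cong refl)
      fix i assume "i \<in> - T"
      then have i: "i \<notin> T" "i \<noteq> j" "i \<notin> R" using T by auto
      show "(if lookup u i = 0 then 0 else sg i T * lookup (htpy f (insert i T)) (u - Poly_Mapping.single i 1))
        = - (if lookup u i = 0 then 0 else sg j R * sg i R *
             lookup (f (insert i R)) (u + Poly_Mapping.single j 1 - Poly_Mapping.single i 1))"
      proof (cases "lookup u i = 0")
        case False
        have "u - Poly_Mapping.single i 1 + Poly_Mapping.single j 1 = u + Poly_Mapping.single j 1 - Poly_Mapping.single i 1"
          using False i by (intro poly_mapping_eqI) (auto simp: lookup_add lookup_minus lookup_single when_def)
        moreover have "insert i T - {j} = insert i R" using T i by auto
        ultimately have "sg i T * lookup (htpy f (insert i T)) (u - Poly_Mapping.single i 1)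
          = sg i (insert j R) * sg j (insert i R) * lookup (f (insert i R)) (u + Poly_Mapping.single j 1 - Poly_Mapping.single i 1)"
          using h[OF i(1) False] True T(1) by (simp add: mult.assoc)
        also have "sg i (insert j R) * sg j (insert i R) = - (sg j R * sg i R :: 'b)"
          by (rule sg_anticomm') (use i T in auto)
        finally show ?thesis using False by simp
      qed simp
    qed
    with 1 show ?thesis by simp
  qed
qed

text \<open>Over S the Koszul complex is acyclic except for the constants in multidegree zero; the
  second assumption removes exactly these.\<close>

lemma koszul_htpy_cycle:
  assumes "\<And>T'. Suc (card T') = card T \<Longrightarrow> koszul f T' = 0"
    and "T = {} \<Longrightarrow> lookup (f {}) 0 = 0"
  shows "koszul (htpy f) T = f T"
proof (intro poly_mapping_eqI)
  fix u
  show "lookup (koszul (htpy f) T) u = lookup (f T) u"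
  proof (cases "u + ind T = 0")
    case True
    have "lookup u j + of_bool (j \<in> T) = 0" for j
      using arg_cong[OF True, of "\<lambda>x. lookup x j"] by (simp add: lookup_add)
    then have "T = {}" "u = 0" by (auto intro!: poly_mapping_eqI)
    then show ?thesis using assms(2) by simp
  next
    case False
    then show ?thesis using htpy_koszul[OF False, of f] htpy_0[of T "koszul f"] assms(1) by simp
  qed
qed

section \<open>Ranks in a minimal resolution\<close>

lemma total_degree_add: "total_degree (a + b) = total_degree a + total_degree b"
  by (simp add: total_degree_def lookup_add sum.distrib)

lemma total_degree_ind: "total_degree (ind T) = card T"
  by (simp add: total_degree_def)

lemma total_degree_le_card:
  fixes b :: "'n::finite expvec"
  assumes "\<And>j. lookup b j \<le> 1"
  shows "total_degree b \<le> CARD('n)"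
  unfolding total_degree_def using sum_bounded_above[of UNIV "lookup b" 1] assms by simp

lemma keys_sum_subset:
  assumes "\<And>x. x \<in> X \<Longrightarrow> keys (f x) \<subseteq> U"
  shows "keys (sum f X) \<subseteq> U"
proof
  fix e assume "e \<in> keys (sum f X)"
  then have "(\<Sum>x\<in>X. lookup (f x) e) \<noteq> 0" by (simp add: in_keys_iff lookup_sum)
  then obtain x where "x \<in> X" "lookup (f x) e \<noteq> 0" by (meson sum.not_neutral_contains_not_neutral)
  then show "e \<in> U" using assms by (metis in_keys_iff subsetD)
qed

lemma keys_diff_subset:
  fixes p q :: "'i \<Rightarrow>\<^sub>0 'b::ab_group_add"
  assumes "keys p \<subseteq> U" "keys q \<subseteq> U"
  shows "keys (p - q) \<subseteq> U"
proof
  fix e assume "e \<in> keys (p - q)"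
  then have "lookup p e \<noteq> 0 \<or> lookup q e \<noteq> 0" by (auto simp: in_keys_iff lookup_minus)
  then show "e \<in> U" using assms by (metis in_keys_iff subsetD)
qed

text \<open>\<open>U\<close> is the set of exponents of the monomials in \<open>M\<close>.\<close>

locale sqfree_exponents =
  fixes U :: "'n::finite expvec set" and k :: nat
  assumes up: "u \<in> U \<Longrightarrow> u + v \<in> U"
    and down: "u + Poly_Mapping.single j 1 \<in> U \<Longrightarrow> lookup u j \<ge> 1 \<Longrightarrow> u \<in> U"
    and degree_gt: "u \<in> U \<Longrightarrow> total_degree u > k"
begin

lemma keys_mult_subset:
  fixes p q :: "('n, 'a::field) mpoly"
  assumes "keys q \<subseteq> U"
  shows "keys (p * q) \<subseteq> U"
  using keys_mult[of p q] assms up by (fastforce simp: add.commute)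

lemma keys_koszul_subset:
  assumes "\<And>j. j \<notin> T \<Longrightarrow> keys (f (insert j T)) \<subseteq> U"
  shows "keys (koszul f T) \<subseteq> U"
  unfolding koszul_def using assms by (intro keys_sum_subset keys_mult_subset) auto

text \<open>If x_j divides x^u, the monomial of \<open>f (T - {j})\<close> involved is divisible by
  the square of x_j and \<open>down\<close> applies. Otherwise the pivot has exponent one in
  \<open>u + ind T\<close>, so by the pivot rule this multidegree is squarefree and has degree at
  most n. The set \<open>T - {j}\<close> uses up at least n - k of it, too much for a coefficient of
  degree above k.\<close>

lemma keys_htpy_subset:
  assumes "\<And>T'. Suc (card T') = card T \<Longrightarrow> keys (f T') \<subseteq> U"
    and "card T > CARD('n) - k"
  shows "keys (htpy f T) \<subseteq> U"
proof
  fix u assume "u \<in> keys (htpy f T)"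
  define j where "j = pivot (u + ind T)"
  have j: "j \<in> T" "lookup (f (T - {j})) (u + Poly_Mapping.single j 1) \<noteq> 0"
    using \<open>u \<in> keys (htpy f T)\<close>
    by (auto simp: in_keys_iff lookup_htpy j_def Let_def split: if_splits)
  have card: "Suc (card (T - {j})) = card T" using j(1) by (intro card_Suc_Diff1) auto
  have U: "u + Poly_Mapping.single j 1 \<in> U" using assms(1)[OF card] j(2) by (auto simp: in_keys_iff)
  show "u \<in> U"
  proof (cases "lookup u j \<ge> 1")
    case True
    then show ?thesis using down U by blast
  next
    case False
    then have "lookup (u + ind T) j \<le> 1" by (simp add: lookup_add)
    then have "lookup (u + ind T) i \<le> 1" for i using lookup_pivot_le_1 j_def by blast
    then have "total_degree (u + ind T) \<le> CARD('n)" by (rule total_degree_le_card)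
    moreover have "u + ind T = u + Poly_Mapping.single j 1 + ind (T - {j})"
      using j(1) by (intro poly_mapping_eqI) (auto simp: lookup_add lookup_single when_def)
    ultimately have "total_degree (u + Poly_Mapping.single j 1) + card (T - {j}) \<le> CARD('n)"
      by (simp add: total_degree_add total_degree_ind)
    then have False using degree_gt[OF U] card assms(2) by linarith
    then show ?thesis ..
  qed
qed

text \<open>The Koszul homology of \<open>S/M\<close> vanishes in degrees \<open>> n - k\<close>.\<close>

lemma koszul_cycle_mod:
  assumes "\<And>T'. Suc (card T') = card T \<Longrightarrow> keys (koszul f T') \<subseteq> U"
    and "card T > CARD('n) - k"
  shows "keys (f T - koszul (htpy f) T) \<subseteq> U"
proof -
  have "f T - koszul (htpy f) T = htpy (koszul f) T"
  proof (intro poly_mapping_eqI)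
    fix u
    have "T \<noteq> {}" using assms(2) by auto
    then obtain j where "j \<in> T" by auto
    have "u + ind T \<noteq> 0"
    proof
      assume "u + ind T = 0"
      from arg_cong[OF this, of "\<lambda>x. lookup x j"] show False using \<open>j \<in> T\<close> by (simp add: lookup_add)
    qed
    from htpy_koszul[OF this, of f]
    show "lookup (f T - koszul (htpy f) T) u = lookup (htpy (koszul f) T) u"
      by (simp add: lookup_minus algebra_simps)
  qed
  then show ?thesis using keys_htpy_subset[OF assms] by simp
qed

end

text \<open>A minimal resolution stripped of matrices and degrees: vectors are functions on
  \<open>nat\<close> of which only the indices below the rank count, membership in M is a condition
  on \<open>keys\<close>, and minimality says that the entries have no constant coefficient.\<close>

locale free_res =
  fixes R :: "nat \<Rightarrow> nat" and D :: "nat \<Rightarrow> nat \<Rightarrow> nat \<Rightarrow> ('n::finite, 'a::field) mpoly"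
    and a :: "nat \<Rightarrow> ('n, 'a) mpoly" and U :: "'n expvec set"
  assumes aug_surj: "\<exists>v. keys ((\<Sum>c<R 0. a c * v c) - g) \<subseteq> U"
    and exact_0: "keys (\<Sum>c<R 0. a c * v c) \<subseteq> U \<longleftrightarrow> (\<exists>w. \<forall>c<R 0. v c = (\<Sum>e<R (Suc 0). D 0 c e * w e))"
    and exact_Suc: "(\<forall>r<R i. (\<Sum>c<R (Suc i). D i r c * v c) = 0) \<longleftrightarrow>
          (\<exists>w. \<forall>c<R (Suc i). v c = (\<Sum>e<R (Suc (Suc i)). D (Suc i) c e * w e))"
    and minimal: "r < R i \<Longrightarrow> c < R (Suc i) \<Longrightarrow> lookup (D i r c) 0 = 0"
begin

text \<open>The kernel of the map leaving F_q, which goes to S/M for q = 0. It lets the shift treat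
  the augmentation and the differentials alike.\<close>

fun Ker :: "nat \<Rightarrow> (nat \<Rightarrow> ('n, 'a) mpoly) \<Rightarrow> bool" where
  "Ker 0 v \<longleftrightarrow> keys (\<Sum>c<R 0. a c * v c) \<subseteq> U"
| "Ker (Suc i) v \<longleftrightarrow> (\<forall>r<R i. (\<Sum>c<R (Suc i). D i r c * v c) = 0)"

lemma exact: "Ker q v \<longleftrightarrow> (\<exists>w. \<forall>c<R q. v c = (\<Sum>e<R (Suc q). D q c e * w e))"
  using exact_0 exact_Suc by (cases q) simp_all

lemma Ker_cong: "(\<And>c. c < R q \<Longrightarrow> v c = w c) \<Longrightarrow> Ker q v \<longleftrightarrow> Ker q w"
  by (simp add: exact)

text \<open>
  Vanishing of the Koszul homology in degree \<open>p\<close> of the image of \<open>F\<^bsub>q\<^esub>\<close> under its differential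
  (of \<open>S/M\<close> if \<open>q = 0\<close>).
\<close>

definition koszul_exact :: "nat \<Rightarrow> nat \<Rightarrow> bool" where
  "koszul_exact q p \<longleftrightarrow> (\<forall>f. (\<forall>T. Suc (card T) = p \<longrightarrow> Ker q (\<lambda>c. koszul (\<lambda>T. f T c) T)) \<longrightarrow>
     (\<exists>y. \<forall>T. card T = p \<longrightarrow> Ker q (\<lambda>c. f T c - koszul (\<lambda>T. y T c) T)))"

text \<open>A chase in 0 -> Ker q -> F_q -> F_q / Ker q -> 0. The cycle \<open>z\<close> bounds some
  \<open>w\<close> in F_q, by acyclicity over S; \<open>w\<close> is a cycle modulo Ker q, and
  subtracting a boundary moves it into Ker q, the image of \<open>D q\<close>, without changing its
  differential \<open>z\<close>. The last assumption covers the constants, which obstruct acyclicity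
  in degree 0.\<close>

lemma lift_cycle:
  assumes "koszul_exact q (Suc p)"
    and "\<And>T. card T = p \<Longrightarrow> Ker q (z T)"
    and "\<And>T c. Suc (card T) = p \<Longrightarrow> c < R q \<Longrightarrow> koszul (\<lambda>T. z T c) T = 0"
    and "\<And>c. p = 0 \<Longrightarrow> c < R q \<Longrightarrow> lookup (z {} c) 0 = 0"
  shows "\<exists>g. \<forall>T. card T = p \<longrightarrow>
    (\<forall>c<R q. z T c = (\<Sum>e<R (Suc q). D q c e * koszul (\<lambda>T. g T e) T))"
proof -
  define w where "w T c = htpy (\<lambda>T. z T c) T" for T c
  have kw: "koszul (\<lambda>T. w T c) T = z T c" if "card T = p" "c < R q" for T c
    unfolding w_def using that assms(3,4) by (intro koszul_htpy_cycle) auto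
  have "Ker q (\<lambda>c. koszul (\<lambda>T. w T c) T)" if "card T = p" for T
    using assms(2)[OF that] kw[OF that] Ker_cong by (metis (no_types, lifting))
  then obtain y where y: "\<And>T. card T = Suc p \<Longrightarrow> Ker q (\<lambda>c. w T c - koszul (\<lambda>T. y T c) T)"
    using assms(1)[unfolded koszul_exact_def, rule_format, of w] by auto
  have "\<exists>w'. \<forall>c<R q. w T c - koszul (\<lambda>T. y T c) T = (\<Sum>e<R (Suc q). D q c e * w' e)"
    if "card T = Suc p" for T
    using y[OF that] by (simp add: exact)
  then obtain g where g: "\<And>T c. card T = Suc p \<Longrightarrow> c < R q \<Longrightarrow>
      w T c - koszul (\<lambda>T. y T c) T = (\<Sum>e<R (Suc q). D q c e * g T e)"
    by metis
  have "z T c = (\<Sum>e<R (Suc q). D q c e * koszul (\<lambda>T. g T e) T)" if "card T = p" "c < R q" for T c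
  proof -
    have "(\<Sum>e<R (Suc q). D q c e * koszul (\<lambda>T. g T e) T)
        = koszul (\<lambda>T. w T c - koszul (\<lambda>T. y T c) T) T"
      unfolding koszul_sum_mult[symmetric] using that g by (intro koszul_cong) simp
    also have "\<dots> = z T c" using kw[OF that] by (simp add: koszul_diff)
    finally show ?thesis ..
  qed
  then show ?thesis by blast
qed

text \<open>The connecting map of the same sequence, with Ker q being the image of F_{q+1}. Since p
  > 0, the condition on constant coefficients in \<open>lift_cycle\<close> is vacuous.\<close>

lemma koszul_exact_shift:
  assumes "koszul_exact q (Suc p)" "p > 0"
  shows "koszul_exact (Suc q) p"
  unfolding koszul_exact_def
proof (intro allI impI)
  fix f assume f: "\<forall>T. Suc (card T) = p \<longrightarrow> Ker (Suc q) (\<lambda>c. koszul (\<lambda>T. f T c) T)"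
  define z where "z T r = (\<Sum>c<R (Suc q). D q r c * f T c)" for T r
  have "\<exists>g. \<forall>T. card T = p \<longrightarrow>
    (\<forall>c<R q. z T c = (\<Sum>e<R (Suc q). D q c e * koszul (\<lambda>T. g T e) T))"
    using assms f
    by (intro lift_cycle) (auto simp: exact[of q] z_def koszul_sum_mult)
  then show "\<exists>y. \<forall>T. card T = p \<longrightarrow> Ker (Suc q) (\<lambda>c. f T c - koszul (\<lambda>T. y T c) T)"
    by (simp add: z_def right_diff_distrib sum_subtractf)
qed

text \<open>A form of Nakayama's lemma. If F_{q+1} has a basis element 0, minimality puts column 0
  of \<open>D q\<close> into (x_1, ..., x_n) F_q, so \<open>lift_cycle\<close> applies in Koszul
  degree 0 and writes this column as \<open>D q\<close> applied to a boundary. The difference of the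
  basis element and the boundary is a syzygy whose entry at 0 has constant coefficient 1, while
  exactness and minimality of the next matrix force 0.\<close>

lemma rank_0:
  assumes "koszul_exact q (Suc 0)"
  shows "R (Suc q) = 0"
proof (rule ccontr)
  assume "R (Suc q) \<noteq> 0"
  define \<delta> where "\<delta> e = (if e = 0 then 1 else 0 :: ('n, 'a) mpoly)" for e :: nat
  have D0: "D q r 0 = (\<Sum>e<R (Suc q). D q r e * \<delta> e)" for r
    using \<open>R (Suc q) \<noteq> 0\<close> by (simp add: \<delta>_def if_distrib[of "(*) _"] sum.delta cong: if_cong)
  have "\<exists>g. \<forall>T. card T = 0 \<longrightarrow>
    (\<forall>c<R q. D q c 0 = (\<Sum>e<R (Suc q). D q c e * koszul (\<lambda>T. g T e) T))"
  proof (intro lift_cycle)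
    show "Ker q (\<lambda>c. D q c 0)"
      unfolding exact[of q] using D0 by blast
  
    fix c :: nat assume "c < R q"
    then show "lookup (D q c 0) 0 = 0" using minimal \<open>R (Suc q) \<noteq> 0\<close> by simp
  qed (use assms in simp_all)
  then obtain g where g: "\<And>c. c < R q \<Longrightarrow> D q c 0 = (\<Sum>e<R (Suc q). D q c e * koszul (\<lambda>T. g T e) {})"
    by (elim exE allE[of _ "{}"]) auto
  have "Ker (Suc q) (\<lambda>e. \<delta> e - koszul (\<lambda>T. g T e) {})"
    using g by (simp add: right_diff_distrib sum_subtractf flip: D0)
  then obtain w where "\<delta> 0 - koszul (\<lambda>T. g T 0) {} = (\<Sum>e<R (Suc (Suc q)). D (Suc q) 0 e * w e)"
    using exact[of "Suc q"] \<open>R (Suc q) \<noteq> 0\<close> by auto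
  from arg_cong[OF this, of "\<lambda>p. lookup p 0"] show False
    using minimal[of 0 "Suc q"] \<open>R (Suc q) \<noteq> 0\<close>
    by (simp add: \<delta>_def lookup_minus lookup_sum lookup_0_times lookup_one)
qed

lemma koszul_exact_iterate:
  assumes "koszul_exact 0 (q + Suc p)"
  shows "koszul_exact q (Suc p)"
  using assms by (induction q arbitrary: p) (auto intro!: koszul_exact_shift simp flip: add_Suc_right)

end

section \<open>Vanishing of the ranks above n - k\<close>

locale sqfree_free_res = free_res R D a U + sqfree_exponents U k
  for R and D :: "nat \<Rightarrow> nat \<Rightarrow> nat \<Rightarrow> ('n::finite, 'a::field) mpoly" and a U k
begin

lemma koszul_exact_0:
  assumes "p > CARD('n) - k"
  shows "koszul_exact 0 p"
  unfolding koszul_exact_def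
proof (intro allI impI)
  fix f assume f: "\<forall>T. Suc (card T) = p \<longrightarrow> Ker 0 (\<lambda>c. koszul (\<lambda>T. f T c) T)"
  define u where "u T = (\<Sum>c<R 0. a c * f T c)" for T
  \<comment> \<open>The homotopy lives on S, where \<open>u\<close> is the image of the chain; its
    values are lifted to F_0 one T at a time, correctly only up to M.\<close>
  have "\<forall>T. \<exists>v. keys ((\<Sum>c<R 0. a c * v c) - htpy u T) \<subseteq> U"
    by (intro allI aug_surj)
  from choice[OF this] obtain y where y: "\<And>T. keys ((\<Sum>c<R 0. a c * y T c) - htpy u T) \<subseteq> U"
    by blast
  have "Ker 0 (\<lambda>c. f T c - koszul (\<lambda>T. y T c) T)" if T: "card T = p" for T
  proof -
    have "(\<Sum>c<R 0. a c * (f T c - koszul (\<lambda>T. y T c) T))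
       = (u T - koszul (htpy u) T) - koszul (\<lambda>T. (\<Sum>c<R 0. a c * y T c) - htpy u T) T"
      by (simp add: koszul_diff koszul_sum_mult right_diff_distrib sum_subtractf u_def)
    moreover have "keys (u T - koszul (htpy u) T) \<subseteq> U"
      using f T assms by (intro koszul_cycle_mod) (auto simp: u_def koszul_sum_mult)
    moreover have "keys (koszul (\<lambda>T. (\<Sum>c<R 0. a c * y T c) - htpy u T) T) \<subseteq> U"
      using y by (intro keys_koszul_subset)
    ultimately show ?thesis by (simp add: keys_diff_subset)
  qed
  then show "\<exists>y. \<forall>T. card T = p \<longrightarrow> Ker 0 (\<lambda>c. f T c - koszul (\<lambda>T. y T c) T)" by blast
qed

text \<open>Each shift trades one Koszul degree for one step of the resolution: degree i + 1 at S/M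
  becomes degree 1 at step i, which controls the rank of F_{i+1}.\<close>

lemma rank_vanish: "CARD('n) - k < Suc i \<Longrightarrow> R (Suc i) = 0"
  using koszul_exact_0[of "i + Suc 0"] koszul_exact_iterate[of i 0] rank_0[of i] by simp

end

section \<open>Minimal generators of graded kernels\<close>

text \<open>Elimination of the last coordinate: a spanning set for the vectors vanishing there,
  together with at most one vector that does not vanish there.\<close>

lemma subspace_finite_spanning:
  fixes W :: "(nat \<Rightarrow> 'a::field) set"
  assumes "\<And>w w' c. w \<in> W \<Longrightarrow> w' \<in> W \<Longrightarrow> (\<lambda>i. w i - c * w' i) \<in> W"
  shows "\<exists>B. finite B \<and> B \<subseteq> W \<and> (\<forall>w\<in>W. \<exists>\<gamma>. \<forall>i<C. w i = (\<Sum>\<beta>\<in>B. \<gamma> \<beta> * \<beta> i))"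
  using assms
proof (induction C arbitrary: W)
  case 0
  show ?case by (intro exI[of _ "{}"]) auto
next
  case (Suc C)
  define W' where "W' = {w \<in> W. w C = 0}"
  have "\<exists>B. finite B \<and> B \<subseteq> W' \<and> (\<forall>w\<in>W'. \<exists>\<gamma>. \<forall>i<C. w i = (\<Sum>\<beta>\<in>B. \<gamma> \<beta> * \<beta> i))"
    using Suc.prems by (intro Suc.IH) (auto simp: W'_def)
  then obtain B where B: "finite B" "B \<subseteq> W'"
    "\<And>w. w \<in> W' \<Longrightarrow> \<exists>\<gamma>. \<forall>i<C. w i = (\<Sum>\<beta>\<in>B. \<gamma> \<beta> * \<beta> i)" by blast
  have BC: "(\<Sum>\<beta>\<in>B. \<gamma> \<beta> * \<beta> C) = 0" for \<gamma>
    using B(2) by (intro sum.neutral) (auto simp: W'_def)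
  show ?case
  proof (cases "W' = W")
    case True
    have "\<exists>\<gamma>. \<forall>i<Suc C. w i = (\<Sum>\<beta>\<in>B. \<gamma> \<beta> * \<beta> i)" if w: "w \<in> W" for w
    proof -
      obtain \<gamma> where \<gamma>: "\<forall>i<C. w i = (\<Sum>\<beta>\<in>B. \<gamma> \<beta> * \<beta> i)" using B(3) w True by auto
      have "w C = 0" using w True by (auto simp: W'_def)
      then show ?thesis using \<gamma> BC[of \<gamma>] by (intro exI[of _ \<gamma>]) (auto simp: less_Suc_eq)
    qed
    then show ?thesis using B True by blast
  next
    case False
    then obtain w0 where w0: "w0 \<in> W" "w0 C \<noteq> 0" by (auto simp: W'_def)
    then have w0B: "w0 \<notin> B" using B(2) by (auto simp: W'_def)
    have "\<exists>\<gamma>. \<forall>i<Suc C. w i = (\<Sum>\<beta>\<in>insert w0 B. \<gamma> \<beta> * \<beta> i)" if "w \<in> W" for w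
    proof -
      define t where "t = w C / w0 C"
      have "(\<lambda>i. w i - t * w0 i) \<in> W'"
        using Suc.prems[OF that w0(1), of t] w0(2) by (simp add: W'_def t_def)
      from B(3)[OF this] obtain \<gamma> where \<gamma>: "\<And>i. i < C \<Longrightarrow> w i - t * w0 i = (\<Sum>\<beta>\<in>B. \<gamma> \<beta> * \<beta> i)"
        by blast
      have *: "(\<Sum>\<beta>\<in>insert w0 B. (\<gamma>(w0 := t)) \<beta> * \<beta> i) = t * w0 i + (\<Sum>\<beta>\<in>B. \<gamma> \<beta> * \<beta> i)" for i
        using w0B B(1) by (auto intro!: sum.cong)
      have "w i = (\<Sum>\<beta>\<in>insert w0 B. (\<gamma>(w0 := t)) \<beta> * \<beta> i)" if "i < Suc C" for i
        unfolding * using that \<gamma>[of i] BC[of \<gamma>] w0(2)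
        by (auto simp: less_Suc_eq t_def algebra_simps)
      then show ?thesis by blast
    qed
    then show ?thesis using B(1,2) w0(1) by (intro exI[of _ "insert w0 B"]) (auto simp: W'_def)
  qed
qed

section \<open>Squarefree degrees and homogeneous entries\<close>

lemma exp_diff_add_diff:
  assumes "a \<preceq> b" "b \<preceq> c"
  shows "(b - a) + (c - b) = c - a"
  using assms by (intro poly_mapping_eqI) (simp add: exp_le_def lookup_add lookup_minus)

lemma exp_le_trans: "a \<preceq> b \<Longrightarrow> b \<preceq> c \<Longrightarrow> a \<preceq> c"
  using order_trans unfolding exp_le_def by blast

lemma ind_keys_le: "ind (keys b) \<preceq> b"
  by (auto simp: exp_le_def in_keys_iff)

lemma squarefree_le_ind_keys:
  assumes "squarefree_expvec a" "a \<preceq> b"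
  shows "a \<preceq> ind (keys b)"
  unfolding exp_le_def
proof
  fix j
  show "lookup a j \<le> lookup (ind (keys b)) j"
    using assms by (auto simp: exp_le_def squarefree_expvec_def in_keys_iff) (metis le_zero_eq)
qed

lemma squarefree_ind [simp]: "squarefree_expvec (ind T)"
  by (simp add: squarefree_expvec_def)

text \<open>Every multidegree of S is at most one-dimensional over K, so an entry between fixed
  degrees is a scalar times one monomial, and graded syzygies become scalar linear algebra.\<close>

lemma homogeneous_eq_single:
  assumes "homogeneous_shift a b p"
  shows "p = Poly_Mapping.single (b - a) (lookup p (b - a))"
    and "lookup p (b - a) \<noteq> 0 \<Longrightarrow> a \<preceq> b"
proof -
  have *: "e = b - a \<and> a \<preceq> b" if "lookup p e \<noteq> 0" for e
  proof -
    have "e + a = b" using that assms by (auto simp: homogeneous_shift_def in_keys_iff)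
    then show ?thesis by (auto simp: exp_le_def lookup_add)
  qed
  then show "p = Poly_Mapping.single (b - a) (lookup p (b - a))"
    by (intro poly_mapping_eqI) (auto simp: lookup_single when_def)
  show "lookup p (b - a) \<noteq> 0 \<Longrightarrow> a \<preceq> b" using * by blast
qed

text \<open>
  A syzygy of multidegree \<open>b\<close> among squarefree degrees is a monomial multiple of one whose
  multidegree is the indicator of the support of \<open>b\<close>; so finitely many multidegrees suffice.
\<close>

lemma graded_kernel_generators:
  fixes D :: "nat \<Rightarrow> nat \<Rightarrow> ('n::finite, 'a::field) mpoly"
  assumes homogeneous: "\<forall>r<R. \<forall>c<C. homogeneous_shift (dr r) (dc c) (D r c)"
    and squarefree: "\<forall>c<C. squarefree_expvec (dc c)"
  shows "\<exists>(I :: ('n set \<times> (nat \<Rightarrow> 'a)) set) g G. finite I \<and>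
    (\<forall>e\<in>I. squarefree_expvec (g e) \<and> (\<forall>c<C. homogeneous_shift (dc c) (g e) (G e c))) \<and>
    (\<forall>v. (\<forall>r<R. (\<Sum>c<C. D r c * v c) = 0) \<longleftrightarrow> (\<exists>w. \<forall>c<C. v c = (\<Sum>e\<in>I. G e c * w e)))"
proof -
  note hom = homogeneous[rule_format] and sqf = squarefree[rule_format]
  define \<kappa> where "\<kappa> r c = lookup (D r c) (dc c - dr r)" for r c
  have D: "D r c = Poly_Mapping.single (dc c - dr r) (\<kappa> r c)" if "r < R" "c < C" for r c
    unfolding \<kappa>_def by (rule homogeneous_eq_single(1)[OF hom[OF that]])
  have \<kappa>: "dr r \<preceq> dc c" if "r < R" "c < C" "\<kappa> r c \<noteq> 0" for r c
    using homogeneous_eq_single(2)[OF hom[OF that(1,2)]] that(3) by (simp add: \<kappa>_def)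
  \<comment> \<open>Scalar coefficient vectors of the syzygies of multidegree \<open>ind S\<close>;
    a component may be nonzero only if its basis degree divides \<open>ind S\<close>.\<close>
  define W where "W S = {\<alpha>. (\<forall>c<C. \<alpha> c \<noteq> 0 \<longrightarrow> dc c \<preceq> ind S) \<and> (\<forall>r<R. (\<Sum>c<C. \<kappa> r c * \<alpha> c) = 0)}" for S
  have "\<exists>B. finite B \<and> B \<subseteq> W S \<and> (\<forall>w\<in>W S. \<exists>\<gamma>. \<forall>i<C. w i = (\<Sum>\<beta>\<in>B. \<gamma> \<beta> * \<beta> i))" for S
  proof (rule subspace_finite_spanning)
    fix w w' c assume "w \<in> W S" "w' \<in> W S"
    then show "(\<lambda>i. w i - c * w' i) \<in> W S"
      by (auto simp: W_def right_diff_distrib sum_subtractf sum_distrib_left[symmetric] mult.left_commute[of _ c])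
  qed
  then have "\<forall>S. \<exists>B. finite B \<and> B \<subseteq> W S \<and> (\<forall>w\<in>W S. \<exists>\<gamma>. \<forall>i<C. w i = (\<Sum>\<beta>\<in>B. \<gamma> \<beta> * \<beta> i))" by blast
  from choice[OF this] obtain B where B: "\<And>S. finite (B S)" "\<And>S. B S \<subseteq> W S"
    "\<And>S w. w \<in> W S \<Longrightarrow> \<exists>\<gamma>. \<forall>i<C. w i = (\<Sum>\<beta>\<in>B S. \<gamma> \<beta> * \<beta> i)" by blast
  define I where "I = Sigma UNIV B"
  define g where "g e = ind (fst e)" for e :: "'n set \<times> (nat \<Rightarrow> 'a)"
  define G where "G e c = Poly_Mapping.single (ind (fst e) - dc c) (snd e c)" for e :: "'n set \<times> (nat \<Rightarrow> 'a)" and c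
  have le: "dc c \<preceq> ind S" if "\<beta> \<in> B S" "c < C" "\<beta> c \<noteq> 0" for S \<beta> c
    using that B(2) by (auto simp: W_def)
  have finI: "finite I" using B(1) by (auto simp: I_def)
  have homG: "homogeneous_shift (dc c) (g e) (G e c)" if "e \<in> I" "c < C" for e c
    using le[of "snd e" "fst e" c] that exp_le_add_diff[of "dc c" "ind (fst e)"]
    by (auto simp: homogeneous_shift_def g_def G_def I_def add.commute)
  have kerG: "(\<Sum>c<C. D r c * G e c) = 0" if r: "r < R" and e: "e \<in> I" for r e
  proof -
    obtain S \<beta> where S: "e = (S, \<beta>)" "\<beta> \<in> B S" using e by (auto simp: I_def)
    have "(\<Sum>c<C. D r c * G e c) = (\<Sum>c<C. Poly_Mapping.single (ind S - dr r) (\<kappa> r c * \<beta> c))"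
    proof (intro sum.cong refl)
      fix c assume "c \<in> {..<C}"
      then show "D r c * G e c = Poly_Mapping.single (ind S - dr r) (\<kappa> r c * \<beta> c)"
        using \<kappa>[OF r, of c] le[OF S(2), of c] exp_diff_add_diff[of "dr r" "dc c" "ind S"]
        by (cases "\<kappa> r c * \<beta> c = 0") (auto simp: D[OF r] G_def S(1) mult_single)
    qed
    also have "\<dots> = Poly_Mapping.single (ind S - dr r) (\<Sum>c<C. \<kappa> r c * \<beta> c)"
      by (intro poly_mapping_eqI) (simp add: lookup_sum lookup_single when_def)
    also have "\<dots> = 0" using S(2) B(2)[of S] r by (auto simp: W_def)
    finally show ?thesis .
  qed
  have "\<exists>w. \<forall>c<C. v c = (\<Sum>e\<in>I. G e c * w e)" if v: "\<forall>r<R. (\<Sum>c<C. D r c * v c) = 0" for v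
  proof -
    \<comment> \<open>Coefficients of the component of \<open>v\<close> in multidegree
      \<open>b\<close>; the guard excludes truncated differences.\<close>
    define \<alpha> where "\<alpha> b c = (if dc c \<preceq> b then lookup (v c) (b - dc c) else 0)" for b c
    have "(\<Sum>c<C. \<kappa> r c * \<alpha> b c) = 0" if r: "r < R" for r b
    proof (cases "dr r \<preceq> b")
      case True
      have "(\<Sum>c<C. \<kappa> r c * \<alpha> b c) = (\<Sum>c<C. lookup (D r c * v c) (b - dr r))"
      proof (intro sum.cong refl)
        fix c assume c: "c \<in> {..<C}"
        show "\<kappa> r c * \<alpha> b c = lookup (D r c * v c) (b - dr r)"
        proof (cases "\<kappa> r c = 0")
          case True
          then show ?thesis using c by (simp add: D[OF r])
        next
          case False
          then have rc: "dr r \<preceq> dc c" using \<kappa>[OF r] c by simp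
          show ?thesis
          proof (cases "dc c \<preceq> b")
            case True
            then show ?thesis using c exp_diff_add_diff[OF rc True]
                lookup_single_times[of "dc c - dr r" "\<kappa> r c" "v c" "b - dc c"]
              by (simp add: D[OF r] \<alpha>_def)
          next
            case False
            have "b - dr r \<noteq> (dc c - dr r) + x" for x
            proof
              assume "b - dr r = (dc c - dr r) + x"
              then have "b = dc c + x"
                using exp_le_add_diff[OF \<open>dr r \<preceq> b\<close>] exp_le_add_diff[OF rc] by (metis add.assoc)
              with False show False by (auto simp: exp_le_iff)
            qed
            then show ?thesis using c False by (simp add: D[OF r] \<alpha>_def lookup_single_times_eq_0)
          qed
        qed
      qed
      also have "\<dots> = 0" using v r by (simp flip: lookup_sum)
      finally show ?thesis .
    next
      case False
      then have "\<kappa> r c * \<alpha> b c = 0" if "c < C" for c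
        using \<kappa>[OF r that] exp_le_trans by (auto simp: \<alpha>_def)
      then show ?thesis by (intro sum.neutral) simp
    qed
    \<comment> \<open>A squarefree basis degree dividing \<open>b\<close> divides its radical, so
      the same scalars form a syzygy in degree \<open>ind (keys b)\<close>.\<close>
    then have \<alpha>W: "\<alpha> b \<in> W (keys b)" for b
      using squarefree_le_ind_keys[OF sqf] by (auto simp: W_def \<alpha>_def split: if_splits)
    then have "\<forall>b. \<exists>\<gamma>. \<forall>c<C. \<alpha> b c = (\<Sum>\<beta>\<in>B (keys b). \<gamma> \<beta> * \<beta> c)" using B(3) by blast
    from choice[OF this] obtain \<gamma> where
      \<gamma>: "\<And>b c. c < C \<Longrightarrow> \<alpha> b c = (\<Sum>\<beta>\<in>B (keys b). \<gamma> b \<beta> * \<beta> c)" by blast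
    define Bs where "Bs = (\<Union>c<C. (\<lambda>e. dc c + e) ` keys (v c))"
    have finBs: "finite Bs" by (simp add: Bs_def)
    \<comment> \<open>The component in multidegree \<open>b\<close> uses only generators attached to
      its support, multiplied by the quotient of x^b by its radical.\<close>
    define w where "w e = (\<Sum>b\<in>{b \<in> Bs. keys b = fst e}. Poly_Mapping.single (b - ind (fst e)) (\<gamma> b (snd e)))" for e
    have "v c = (\<Sum>e\<in>I. G e c * w e)" if c: "c < C" for c
    proof -
      define t where "t b \<beta> = Poly_Mapping.single (b - dc c) (\<gamma> b \<beta> * \<beta> c)" for b \<beta>
      have "(\<Sum>e\<in>I. G e c * w e) = (\<Sum>S\<in>UNIV. \<Sum>\<beta>\<in>B S. G (S, \<beta>) c * w (S, \<beta>))"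
        using B(1) by (simp add: I_def sum.Sigma)
      also have "\<dots> = (\<Sum>S\<in>UNIV. \<Sum>\<beta>\<in>B S. \<Sum>b\<in>{b \<in> Bs. keys b = S}. t b \<beta>)"
      proof (intro sum.cong refl)
        fix S \<beta> assume \<beta>: "\<beta> \<in> B S"
        show "G (S, \<beta>) c * w (S, \<beta>) = (\<Sum>b\<in>{b \<in> Bs. keys b = S}. t b \<beta>)"
          unfolding w_def sum_distrib_left
        proof (intro sum.cong)
          fix b assume "b \<in> {b \<in> Bs. keys b = S}"
          then have "ind S \<preceq> b" using ind_keys_le by blast
          then show "G (S, \<beta>) c * Poly_Mapping.single (b - ind (fst (S, \<beta>))) (\<gamma> b (snd (S, \<beta>))) = t b \<beta>"
            using le[OF \<beta> c] exp_diff_add_diff[of "dc c" "ind S" b]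
            by (cases "\<beta> c = 0") (auto simp: G_def t_def mult_single mult.commute[of "\<beta> c"])
        qed simp
      qed
      also have "\<dots> = (\<Sum>S\<in>UNIV. \<Sum>b\<in>{b \<in> Bs. keys b = S}. \<Sum>\<beta>\<in>B (keys b). t b \<beta>)"
        by (subst sum.swap) (auto intro!: sum.cong)
      also have "\<dots> = (\<Sum>b\<in>Bs. \<Sum>\<beta>\<in>B (keys b). t b \<beta>)"
        using finBs by (intro sum.group) auto
      also have "\<dots> = (\<Sum>b\<in>Bs. Poly_Mapping.single (b - dc c) (\<alpha> b c))"
        by (intro sum.cong refl poly_mapping_eqI) (simp add: t_def lookup_sum lookup_single when_def \<gamma>[OF c])
      also have "\<dots> = v c"
      proof (intro poly_mapping_eqI)
        fix u
        have "lookup (\<Sum>b\<in>Bs. Poly_Mapping.single (b - dc c) (\<alpha> b c)) u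
            = (\<Sum>b\<in>Bs. if b = dc c + u then lookup (v c) u else 0)"
          unfolding lookup_sum
        proof (intro sum.cong refl)
          fix b
          show "lookup (Poly_Mapping.single (b - dc c) (\<alpha> b c)) u = (if b = dc c + u then lookup (v c) u else 0)"
            using exp_le_add_diff[of "dc c" b]
            by (auto simp: lookup_single when_def \<alpha>_def exp_le_iff)
        qed
        also have "\<dots> = lookup (v c) u"
        proof -
          have "dc c + u \<in> Bs" if "lookup (v c) u \<noteq> 0"
            unfolding Bs_def using that c by (intro UN_I[of c] imageI) (auto simp: in_keys_iff)
          then show ?thesis using finBs by (auto simp: sum.delta)
        qed
        finally show "lookup (\<Sum>b\<in>Bs. Poly_Mapping.single (b - dc c) (\<alpha> b c)) u = lookup (v c) u" .
      qed
      finally show ?thesis ..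
    qed
    then show ?thesis by blast
  qed
  moreover have "(\<Sum>c<C. D r c * v c) = 0" if "r < R" "\<forall>c<C. v c = (\<Sum>e\<in>I. G e c * w e)" for r v w
  proof -
    have "(\<Sum>c<C. D r c * v c) = (\<Sum>e\<in>I. (\<Sum>c<C. D r c * G e c) * w e)"
      using that(2) by (simp add: sum_distrib_left sum_distrib_right sum.swap[of _ I] mult.assoc)
    then show ?thesis using kerG[OF that(1)] by simp
  qed
  ultimately show ?thesis using finI homG
    by (intro exI[of _ I] exI[of _ g] exI[of _ G] conjI ballI allI impI iffI) (auto simp: g_def)
qed

text \<open>In a generating subfamily of least size no syzygy has a unit coefficient, since dividing
  by it would express that generator by the others. The columns of the next matrix being syzygies,
  this makes the next matrix minimal. The predicate \<open>Z\<close> is abstract so as to cover both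
  M and kernels.\<close>

lemma minimal_generators:
  fixes G :: "'i \<Rightarrow> nat \<Rightarrow> ('n, 'a::field) mpoly"
  assumes fin: "finite I"
    and sqf: "\<And>e. e \<in> I \<Longrightarrow> squarefree_expvec (g e)"
    and hom: "\<And>e c. e \<in> I \<Longrightarrow> c < C \<Longrightarrow> homogeneous_shift (dc c) (g e) (G e c)"
    and gen: "\<And>v. Z v \<longleftrightarrow> (\<exists>w. \<forall>c<C. v c = (\<Sum>e\<in>I. G e c * w e))"
  shows "\<exists>gs H. (\<forall>d\<in>set gs. squarefree_expvec d) \<and>
    (\<forall>c<C. \<forall>e<length gs. homogeneous_shift (dc c) (gs ! e) (H c e)) \<and>
    (\<forall>v. Z v \<longleftrightarrow> (\<exists>w. \<forall>c<C. v c = (\<Sum>e<length gs. H c e * w e))) \<and>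
    (\<forall>w. (\<forall>c<C. (\<Sum>e<length gs. H c e * w e) = 0) \<longrightarrow> (\<forall>e<length gs. \<not> w e dvd 1))"
proof -
  define gens where "gens J \<longleftrightarrow> J \<subseteq> I \<and> (\<forall>v. Z v \<longleftrightarrow> (\<exists>w. \<forall>c<C. v c = (\<Sum>e\<in>J. G e c * w e)))" for J
  have "gens I" using gen by (simp add: gens_def)
  then obtain J where J: "gens J" and least: "\<And>J'. gens J' \<Longrightarrow> card J \<le> card J'"
    using ex_has_least_nat[of gens I card] by blast
  have finJ: "finite J" and JI: "J \<subseteq> I" using J fin finite_subset by (auto simp: gens_def)
  have genJ: "Z v \<longleftrightarrow> (\<exists>w. \<forall>c<C. v c = (\<Sum>e\<in>J. G e c * w e))" for v using J by (simp add: gens_def)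
  have min: "\<not> w r dvd 1" if w: "\<And>c. c < C \<Longrightarrow> (\<Sum>e\<in>J. G e c * w e) = 0" and r: "r \<in> J" for w r
  proof
    assume "w r dvd 1"
    then obtain w' where w': "w r * w' = 1" by (metis dvdE)
    have split: "(\<Sum>e\<in>J. f e) = f r + (\<Sum>e\<in>J - {r}. f e)" for f :: "'i \<Rightarrow> ('n, 'a) mpoly"
      using finJ r by (rule sum.remove)
    have Gr: "G r c = - (\<Sum>e\<in>J - {r}. G e c * (w' * w e))" if "c < C" for c
    proof -
      have "G r c * w r = - (\<Sum>e\<in>J - {r}. G e c * w e)"
        using w[OF that] by (simp add: split add_eq_0_iff)
      then have "G r c * w r * w' = - (\<Sum>e\<in>J - {r}. G e c * w e) * w'" by simp
      then show ?thesis using w'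
        by (simp add: mult.assoc sum_distrib_right mult.commute[of w'])
    qed
    have "gens (J - {r})"
      unfolding gens_def
    proof (intro conjI allI iffI)
      show "J - {r} \<subseteq> I" using JI by blast
    next
      fix v assume "Z v"
      then obtain x where x: "\<And>c. c < C \<Longrightarrow> v c = (\<Sum>e\<in>J. G e c * x e)" using genJ by blast
      have "v c = (\<Sum>e\<in>J - {r}. G e c * (x e - w' * w e * x r))" if "c < C" for c
      proof -
        have "(\<Sum>e\<in>J - {r}. G e c * (x e - w' * w e * x r))
           = (\<Sum>e\<in>J - {r}. G e c * x e) - (\<Sum>e\<in>J - {r}. G e c * (w' * w e)) * x r"
          by (simp add: right_diff_distrib sum_subtractf sum_distrib_right mult.assoc)
        also have "(\<Sum>e\<in>J - {r}. G e c * (w' * w e)) = - G r c" using Gr[OF that] by simp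
        finally show ?thesis using x[OF that] by (simp add: split)
      qed
      then show "\<exists>w. \<forall>c<C. v c = (\<Sum>e\<in>J - {r}. G e c * w e)"
        by (intro exI[of _ "\<lambda>e. x e - w' * w e * x r"]) blast
    next
      fix v assume "\<exists>w. \<forall>c<C. v c = (\<Sum>e\<in>J - {r}. G e c * w e)"
      then obtain x where x: "\<And>c. c < C \<Longrightarrow> v c = (\<Sum>e\<in>J - {r}. G e c * x e)" by blast
      have "v c = (\<Sum>e\<in>J. G e c * (x(r := 0)) e)" if "c < C" for c
        using x[OF that] by (simp add: split)
      then show "Z v" using genJ by blast
    qed
    then have "card J \<le> card (J - {r})" by (rule least)
    then show False using r finJ by (metis card_Diff1_less not_less)
  qed
  \<comment> \<open>Generators are renumbered by an initial segment of \<open>nat\<close>, to match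
    a list of degrees.\<close>
  obtain h where h: "bij_betw h {..<card J} J"
    using ex_bij_betw_nat_finite[OF finJ] by (auto simp: atLeast0LessThan)
  define gs where "gs = map (g \<circ> h) [0..<card J]"
  define H where "H c e = G (h e) c" for c e
  have hJ: "h e \<in> J" if "e < card J" for e using h that by (auto simp: bij_betw_def)
  have sumJ: "(\<Sum>e<card J. H c e * w (h e)) = (\<Sum>e\<in>J. G e c * w e)" for c and w :: "'i \<Rightarrow> ('n, 'a) mpoly"
    unfolding H_def by (rule sum.reindex_bij_betw[OF h])
  define h' where "h' = inv_into {..<card J} h"
  have h': "h' (h e) = e" if "e < card J" for e
    unfolding h'_def using h that by (intro inv_into_f_f) (auto simp: bij_betw_def)
  have sumJ': "(\<Sum>e<card J. H c e * w e) = (\<Sum>e\<in>J. G e c * w (h' e))" for c and w :: "nat \<Rightarrow> ('n, 'a) mpoly"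
    unfolding sumJ[symmetric] using h' by (intro sum.cong refl) simp
  have len: "length gs = card J" by (simp add: gs_def)
  show ?thesis
  proof (intro exI[of _ gs] exI[of _ H] conjI, unfold len)
    show "\<forall>d\<in>set gs. squarefree_expvec d" using subsetD[OF JI hJ] sqf by (auto simp: gs_def)
    show "\<forall>c<C. \<forall>e<card J. homogeneous_shift (dc c) (gs ! e) (H c e)"
      using subsetD[OF JI hJ] hom by (auto simp: gs_def H_def)
    show "\<forall>v. Z v \<longleftrightarrow> (\<exists>w. \<forall>c<C. v c = (\<Sum>e<card J. H c e * w e))"
    proof (intro allI iffI)
      fix v assume "Z v"
      then obtain w where "\<forall>c<C. v c = (\<Sum>e\<in>J. G e c * w e)" using genJ by blast
      then show "\<exists>w. \<forall>c<C. v c = (\<Sum>e<card J. H c e * w e)"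
        unfolding sumJ[symmetric] by (intro exI[of _ "\<lambda>e. w (h e)"])
    next
      fix v assume "\<exists>w. \<forall>c<C. v c = (\<Sum>e<card J. H c e * w e)"
      then obtain w where "\<forall>c<C. v c = (\<Sum>e<card J. H c e * w e)" ..
      then show "Z v" unfolding genJ sumJ' by (rule exI[of _ "\<lambda>e. w (h' e)"])
    qed
    show "\<forall>w. (\<forall>c<C. (\<Sum>e<card J. H c e * w e) = 0) \<longrightarrow> (\<forall>e<card J. \<not> w e dvd 1)"
    proof (intro allI impI)
      fix w e assume "\<forall>c<C. (\<Sum>e<card J. H c e * w e) = 0" "e < card J"
      then show "\<not> w e dvd 1" using min[of "\<lambda>e. w (h' e)" "h e"] hJ h' by (simp add: sumJ')
    qed
  qed
qed

lemma minimal_kernel_generators: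
  fixes D :: "nat \<Rightarrow> nat \<Rightarrow> ('n::finite, 'a::field) mpoly"
  assumes "\<forall>r<R. \<forall>c<C. homogeneous_shift (dr r) (dc c) (D r c)"
    and "\<forall>c<C. squarefree_expvec (dc c)"
  shows "\<exists>gs H. (\<forall>d\<in>set gs. squarefree_expvec d) \<and>
    (\<forall>c<C. \<forall>e<length gs. homogeneous_shift (dc c) (gs ! e) (H c e)) \<and>
    (\<forall>v. (\<forall>r<R. (\<Sum>c<C. D r c * v c) = 0) \<longleftrightarrow> (\<exists>w. \<forall>c<C. v c = (\<Sum>e<length gs. H c e * w e))) \<and>
    (\<forall>w. (\<forall>c<C. (\<Sum>e<length gs. H c e * w e) = 0) \<longrightarrow> (\<forall>e<length gs. \<not> w e dvd 1))"
proof -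
  obtain I :: "('n set \<times> (nat \<Rightarrow> 'a)) set" and g G where *: "finite I"
    "\<forall>e\<in>I. squarefree_expvec (g e) \<and> (\<forall>c<C. homogeneous_shift (dc c) (g e) (G e c))"
    "\<forall>v. (\<forall>r<R. (\<Sum>c<C. D r c * v c) = 0) \<longleftrightarrow> (\<exists>w. \<forall>c<C. v c = (\<Sum>e\<in>I. G e c * w e))"
    using graded_kernel_generators[OF assms] by (elim exE conjE) (rule that)
  show ?thesis
  proof (rule minimal_generators[OF *(1)])
    show "squarefree_expvec (g e)" if "e \<in> I" for e using that *(2) by simp
    show "homogeneous_shift (dc c) (g e) (G e c)" if "e \<in> I" "c < C" for e c using that *(2) by simp
    show "(\<forall>r<R. (\<Sum>c<C. D r c * v c) = 0) \<longleftrightarrow> (\<exists>w. \<forall>c<C. v c = (\<Sum>e\<in>I. G e c * w e))" for v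
      using *(3) by (rule spec)
  qed
qed

section \<open>Minimal free resolutions of squarefree monomial ideals\<close>

lemma module_times: "Modules.module ((*) :: 'r::comm_ring_1 \<Rightarrow> 'r \<Rightarrow> 'r)"
  by unfold_locales (auto simp: algebra_simps)

definition multiples :: "'n expvec set \<Rightarrow> 'n expvec set" where
  "multiples E = {e + d | e d. e \<in> E}"

lemma single_eq_times_monomial:
  "Poly_Mapping.single (e + d) c = Poly_Mapping.single d c * (monomial e :: ('n, 'a::field) mpoly)"
  by (simp add: monomial_def mult_single add.commute)

lemma keys_monomial [simp]: "keys (monomial e :: ('n, 'a::field) mpoly) = {e}"
  by (simp add: monomial_def)

text \<open>Multiples of the generating monomials span the ideal over K, so membership is decided on
  the exponents alone.\<close>

lemma ideal_of_monomials:
  "ideal_of (monomial ` E) = {f :: ('n, 'a::field) mpoly. keys f \<subseteq> multiples E}"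
proof -
  interpret P: Modules.module "(*) :: ('n, 'a) mpoly \<Rightarrow> _" by (rule module_times)
  have "P.span (monomial ` E) \<subseteq> {f :: ('n, 'a) mpoly. keys f \<subseteq> multiples E}"
  proof (rule P.span_minimal)
    show "monomial ` E \<subseteq> {f :: ('n, 'a) mpoly. keys f \<subseteq> multiples E}"
      by (auto simp: monomial_def multiples_def) (metis add.right_neutral)
    show "P.subspace {f :: ('n, 'a) mpoly. keys f \<subseteq> multiples E}"
    proof (rule P.subspaceI; clarsimp)
      fix f g :: "('n, 'a) mpoly" and x
      assume "keys f \<subseteq> multiples E" "keys g \<subseteq> multiples E" "x \<in> keys (f + g)"
      then show "x \<in> multiples E" using Poly_Mapping.keys_add[of f g] by blast
    next
      fix p f :: "('n, 'a) mpoly" and x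
      assume f: "keys f \<subseteq> multiples E" and "x \<in> keys (p * f)"
      then obtain a b where "x = a + b" "b \<in> multiples E" using keys_mult[of p f] by blast
      then show "x \<in> multiples E" unfolding multiples_def
        by (auto simp: ac_simps)
    qed
  qed
  moreover have "f \<in> P.span (monomial ` E)" if f: "keys f \<subseteq> multiples E" for f :: "('n, 'a) mpoly"
  proof (subst poly_mapping_sum_single, rule P.span_sum)
    fix u assume "u \<in> keys f"
    then obtain e d where "u = e + d" "e \<in> E" using f by (auto simp: multiples_def)
    then show "Poly_Mapping.single u (lookup f u) \<in> P.span (monomial ` E)"
      by (simp add: single_eq_times_monomial P.span_scale P.span_base)
  qed
  ultimately show ?thesis by (auto simp: ideal_of_def)
qed

lemma inj_monomial: "inj (monomial :: 'n expvec \<Rightarrow> ('n, 'a::field) mpoly)"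
  by (rule injI) (metis keys_single monomial_def singleton_inject zero_neq_one)

lemma mem_ideal_of_monomials:
  assumes "finite E"
  shows "f \<in> ideal_of (monomial ` E) \<longleftrightarrow> (\<exists>w. f = (\<Sum>e\<in>E. (monomial e :: ('n, 'a::field) mpoly) * w e))"
proof -
  interpret P: Modules.module "(*) :: ('n, 'a) mpoly \<Rightarrow> _" by (rule module_times)
  have *: "ideal_of (monomial ` E) = range (\<lambda>u :: ('n, 'a) mpoly \<Rightarrow> ('n, 'a) mpoly. \<Sum>e\<in>E. u (monomial e) * monomial e)"
    unfolding ideal_of_def using assms
    by (subst P.span_finite) (simp_all add: sum.reindex[OF inj_on_subset[OF inj_monomial subset_UNIV]])
  have "\<exists>u :: ('n, 'a) mpoly \<Rightarrow> ('n, 'a) mpoly. (\<Sum>e\<in>E. monomial e * w e) = (\<Sum>e\<in>E. u (monomial e) * monomial e)" for w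
    by (intro exI[of _ "\<lambda>x. w (inv_into UNIV monomial x)"])
      (simp add: inv_f_f[OF inj_monomial] mult.commute)
  then show ?thesis unfolding * by (auto simp: mult.commute)
qed

lemma finite_squarefree: "finite {e :: 'n::finite expvec. squarefree_expvec e}"
proof (rule finite_subset)
  show "{e. squarefree_expvec e} \<subseteq> range (ind :: 'n set \<Rightarrow> _)"
  proof
    fix e :: "'n expvec" assume "e \<in> {e. squarefree_expvec e}"
    then have "lookup e j \<le> 1" for j by (simp add: squarefree_expvec_def)
    then have "lookup e j = lookup (ind (keys e)) j" for j
      using le_Suc_eq[of "lookup e j" 0] by (auto simp: in_keys_iff)
    then have "e = ind (keys e)" by (rule poly_mapping_eqI)
    then show "e \<in> range ind" by blast
  qed
qed simp

lemma sqfree_exponents_multiples: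
  assumes sqf: "\<And>e. e \<in> E \<Longrightarrow> squarefree_expvec e"
    and deg: "\<And>u. u \<in> multiples E \<Longrightarrow> total_degree u > k"
  shows "sqfree_exponents (multiples E) k"
proof
  fix u v :: "'a expvec" assume "u \<in> multiples E"
  then show "u + v \<in> multiples E" unfolding multiples_def by (auto simp: add.assoc) blast
next
  fix u :: "'a expvec" and j
  assume "u + Poly_Mapping.single j 1 \<in> multiples E" and uj: "lookup u j \<ge> 1"
  then obtain e d where e: "e \<in> E" "u + Poly_Mapping.single j 1 = e + d" by (auto simp: multiples_def)
  have *: "lookup u i + lookup (Poly_Mapping.single j 1) i = lookup e i + lookup d i" for i
    using arg_cong[OF e(2), of "\<lambda>x. lookup x i"] by (simp add: lookup_add)
  \<comment> \<open>The square of x_j divides the monomial but not the generator \<open>e\<close>,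
    so x_j can be cancelled from the cofactor \<open>d\<close>.\<close>
  have "lookup e j \<le> 1" using sqf[OF e(1)] by (simp add: squarefree_expvec_def)
  then have "lookup d j \<ge> 1" using *[of j] uj by simp
  then have "lookup u i = lookup e i + (lookup d i - lookup (Poly_Mapping.single j 1) i)" for i
    using *[of i] by (cases "i = j") (auto simp: lookup_single when_def)
  then have "u = e + (d - Poly_Mapping.single j 1)"
    by (intro poly_mapping_eqI) (simp add: lookup_add lookup_minus)
  then show "u \<in> multiples E" using e(1) by (auto simp: multiples_def)
qed (use deg in auto)

section \<open>Resolutions by matrices translated into index functions\<close>

lemma vec_set_eq_iff:
  assumes "A \<subseteq> carrier_vec N" "B \<subseteq> carrier_vec N"
  shows "A = B \<longleftrightarrow> (\<forall>v. vec N v \<in> A \<longleftrightarrow> vec N v \<in> B)"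
proof
  assume *: "\<forall>v. vec N v \<in> A \<longleftrightarrow> vec N v \<in> B"
  have "x \<in> A \<longleftrightarrow> x \<in> B" if "x \<in> carrier_vec N" for x
  proof -
    have "x = vec N (\<lambda>i. x $ i)" using that by auto
    then show ?thesis using * by metis
  qed
  then show "A = B" using assms by blast
qed simp

lemma coset_eq_iff:
  fixes f g :: "('n, 'a::field) mpoly"
  shows "f +o {p. keys p \<subseteq> U} = g +o {p. keys p \<subseteq> U} \<longleftrightarrow> keys (f - g) \<subseteq> U"
proof
  assume "f +o {p. keys p \<subseteq> U} = g +o {p. keys p \<subseteq> U}"
  moreover have "f \<in> f +o {p. keys p \<subseteq> U}" by (auto simp: elt_set_plus_def)
  ultimately obtain p where "f = g + p" "keys p \<subseteq> U" by (auto simp: elt_set_plus_def)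
  then show "keys (f - g) \<subseteq> U" by simp
next
  assume *: "keys (f - g) \<subseteq> U"
  have "x \<in> f +o {p. keys p \<subseteq> U} \<longleftrightarrow> keys (x - f) \<subseteq> U" for x f :: "('n, 'a) mpoly"
    by (auto simp: elt_set_plus_def intro: exI[of _ "x - f"])
  moreover have "keys (x - f) \<subseteq> U \<longleftrightarrow> keys (x - g) \<subseteq> U" for x
    using keys_diff_subset[of "x - g" U "f - g"] keys_diff_subset[of "x - f" U "g - f"] *
      keys_diff_subset[of 0 U "f - g"] by auto
  ultimately show "f +o {p. keys p \<subseteq> U} = g +o {p. keys p \<subseteq> U}" by blast
qed

lemma free_resolution_iff:
  fixes F :: "('n, 'a::field) aug_complex"
  assumes F: "multigraded F" and M: "M = {f. keys f \<subseteq> U}"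
  shows "free_resolution M F \<longleftrightarrow>
    (\<forall>g. \<exists>v. keys ((\<Sum>c<free_rank F 0. aug F $ c * v c) - g) \<subseteq> U) \<and>
    (\<forall>v. keys (\<Sum>c<free_rank F 0. aug F $ c * v c) \<subseteq> U \<longleftrightarrow>
       (\<exists>w. \<forall>c<free_rank F 0. v c = (\<Sum>e<free_rank F (Suc 0). diff F 0 $$ (c, e) * w e))) \<and>
    (\<forall>i v. (\<forall>r<free_rank F i. (\<Sum>c<free_rank F (Suc i). diff F i $$ (r, c) * v c) = 0) \<longleftrightarrow>
       (\<exists>w. \<forall>c<free_rank F (Suc i). v c = (\<Sum>e<free_rank F (Suc (Suc i)). diff F (Suc i) $$ (c, e) * w e)))"
proof -
  let ?R = "free_rank F"
  have dim: "dim_row (diff F i) = ?R i" "dim_col (diff F i) = ?R (Suc i)" for i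
    using F by (auto simp: multigraded_def)
  have mult: "(diff F i *\<^sub>v vec (?R (Suc i)) v) $ r = (\<Sum>c<?R (Suc i). diff F i $$ (r, c) * v c)"
    if "r < ?R i" for i v r
    using that dim[of i] by (auto simp: scalar_prod_def atLeast0LessThan intro!: sum.cong)
  have aug: "aug F \<bullet> vec (?R 0) v = (\<Sum>c<?R 0. aug F $ c * v c)" for v
    by (auto simp: scalar_prod_def atLeast0LessThan intro!: sum.cong)
  have vec_surj: "x \<in> carrier_vec N \<longleftrightarrow> (\<exists>v. x = vec N v)" for N and x :: "('n, 'a) mpoly vec"
    by (auto intro!: exI[of _ "\<lambda>i. x $ i"])
  have im: "vec (?R i) v \<in> diff_image F i \<longleftrightarrow>
      (\<exists>w. \<forall>c<?R i. v c = (\<Sum>e<?R (Suc i). diff F i $$ (c, e) * w e))" for i v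
  proof -
    have "vec (?R i) v \<in> diff_image F i \<longleftrightarrow> (\<exists>w. vec (?R i) v = diff F i *\<^sub>v vec (?R (Suc i)) w)"
      unfolding diff_image_def free_mod_def by (auto simp: vec_surj image_iff Bex_def)
    also have "\<dots> \<longleftrightarrow> (\<exists>w. \<forall>c<?R i. v c = (\<Sum>e<?R (Suc i). diff F i $$ (c, e) * w e))"
      using mult dim by (intro ex_cong1) (auto simp: vec_eq_iff)
    finally show ?thesis .
  qed
  have im_carrier: "diff_image F i \<subseteq> carrier_vec (?R i)" for i
    using dim by (auto simp: diff_image_def intro!: carrier_vecI)
  have ker: "vec (?R (Suc i)) v \<in> mat_kernel (diff F i) \<longleftrightarrow>
      (\<forall>r<?R i. (\<Sum>c<?R (Suc i). diff F i $$ (r, c) * v c) = 0)" for i v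
    using mult dim by (auto simp: mat_kernel_def vec_eq_iff)
  have ker_carrier: "mat_kernel (diff F i) \<subseteq> carrier_vec (?R (Suc i))" for i
    using dim by (auto simp: mat_kernel_def)
  have "aug_map M F ` free_mod F 0 \<subseteq> quotient_ring M"
    by (auto simp: aug_map_def quotient_ring_def)
  moreover have "quotient_ring M \<subseteq> aug_map M F ` free_mod F 0 \<longleftrightarrow>
      (\<forall>g. \<exists>v. aug_map M F (vec (?R 0) v) = g +o M)"
    unfolding quotient_ring_def free_mod_def image_subset_iff image_iff Bex_def vec_surj
    by (simp add: ex_simps(1)[symmetric] eq_commute del: ex_simps)
  ultimately have "aug_map M F ` free_mod F 0 = quotient_ring M \<longleftrightarrow>
      (\<forall>g. \<exists>v. aug_map M F (vec (?R 0) v) = g +o M)"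
    by blast
  also have "\<dots> \<longleftrightarrow> (\<forall>g. \<exists>v. keys ((\<Sum>c<?R 0. aug F $ c * v c) - g) \<subseteq> U)"
    by (simp add: aug_map_def aug M coset_eq_iff)
  finally have 1: "aug_map M F ` free_mod F 0 = quotient_ring M \<longleftrightarrow> \<dots>" .
  have aug0: "aug_map M F x = 0 +o M \<longleftrightarrow> keys (aug F \<bullet> x) \<subseteq> U" for x
    unfolding aug_map_def M coset_eq_iff by simp
  have "{v \<in> free_mod F 0. aug_map M F v = 0 +o M} = diff_image F 0 \<longleftrightarrow>
    (\<forall>v. keys (\<Sum>c<?R 0. aug F $ c * v c) \<subseteq> U \<longleftrightarrow>
       (\<exists>w. \<forall>c<?R 0. v c = (\<Sum>e<?R (Suc 0). diff F 0 $$ (c, e) * w e)))"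
    by (subst vec_set_eq_iff[of _ "?R 0"]) (use im_carrier in \<open>auto simp: free_mod_def im aug0 aug simp del: set_zero_plus\<close>)
  moreover have "mat_kernel (diff F i) = diff_image F (Suc i) \<longleftrightarrow>
    (\<forall>v. (\<forall>r<?R i. (\<Sum>c<?R (Suc i). diff F i $$ (r, c) * v c) = 0) \<longleftrightarrow>
       (\<exists>w. \<forall>c<?R (Suc i). v c = (\<Sum>e<?R (Suc (Suc i)). diff F (Suc i) $$ (c, e) * w e)))" for i
    by (subst vec_set_eq_iff[OF ker_carrier im_carrier]) (simp add: ker im)
  ultimately show ?thesis using F 1 by (simp add: free_resolution_def)
qed

text \<open>A nonzero constant coefficient forces equal degrees, hence a nonzero constant.
  Homogeneity matters: 1 + x_j is no unit either.\<close>

lemma homogeneous_not_unit: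
  fixes p :: "('n, 'a::field) mpoly"
  assumes "homogeneous_shift a b p" "\<not> p dvd 1"
  shows "lookup p 0 = 0"
proof (rule ccontr)
  assume *: "lookup p 0 \<noteq> 0"
  then have "0 + a = b" using assms(1) by (auto simp: homogeneous_shift_def in_keys_iff)
  then have "p = Poly_Mapping.single 0 (lookup p 0)" using homogeneous_eq_single(1)[OF assms(1)] by simp
  then have "p * Poly_Mapping.single 0 (inverse (lookup p 0)) = 1"
    using * by (metis add_0 mult_single right_inverse single_one)
  then show False using assms(2) by (metis dvdI)
qed

lemma minimal_free_resolution_rank:
  fixes F :: "('n::finite, 'a::field) aug_complex"
  assumes F: "minimal_free_resolution M F" and M: "M = {f. keys f \<subseteq> U}"
    and U: "sqfree_exponents U k" and i: "CARD('n) - k < i"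
  shows "free_rank F i = 0"
proof -
  have res: "free_resolution M F" and mg: "multigraded F"
    using F by (auto simp: minimal_free_resolution_def free_resolution_def)
  have hom: "homogeneous_shift (degs F i ! r) (degs F (Suc i) ! c) (diff F i $$ (r, c))"
    if "r < free_rank F i" "c < free_rank F (Suc i)" for i r c
    using mg that by (auto simp: multigraded_def)
  interpret sqfree_exponents U k by (rule U)
  interpret sqfree_free_res "free_rank F" "\<lambda>i r c. diff F i $$ (r, c)" "\<lambda>c. aug F $ c" U k
  proof
    fix i r c assume "r < free_rank F i" "c < free_rank F (Suc i)"
    then show "lookup (diff F i $$ (r, c)) 0 = 0"
      using F by (intro homogeneous_not_unit[OF hom]) (auto simp: minimal_free_resolution_def)
  qed (use res free_resolution_iff[OF mg M] in \<open>simp_all only: simp_thms\<close>)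
  show ?thesis using rank_vanish[of "i - 1"] i by simp
qed

section \<open>Existence of a minimal resolution\<close>

lemma sum_delta_times:
  fixes H :: "nat \<Rightarrow> 'r::comm_ring_1"
  shows "e < N \<Longrightarrow> (\<Sum>i<N. H i * (if i = e then x else 0)) = H e * x"
  by (simp add: if_distrib[of "(*) _"] sum.delta cong: if_cong)

text \<open>The construction takes F_0 = S with augmentation 1. Then M is the image of F_1, and
  \<open>1 \<notin> M\<close> makes the entries of the first matrix non-units.\<close>

lemma minimal_free_resolution_exists:
  fixes M :: "('n::finite, 'a::field) mpoly set"
  assumes M: "squarefree_monomial_ideal M" and proper: "1 \<notin> M"
  shows "\<exists>F. minimal_free_resolution M F"
proof -
  obtain E where E: "\<And>e. e \<in> E \<Longrightarrow> squarefree_expvec e" "M = ideal_of (monomial ` E)"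
    using M by (auto simp: squarefree_monomial_ideal_def)
  have finE: "finite E" by (rule finite_subset[OF _ finite_squarefree]) (use E(1) in auto)
  have "\<exists>gs H. (\<forall>d\<in>set gs. squarefree_expvec d) \<and>
    (\<forall>c<1::nat. \<forall>e<length gs. homogeneous_shift 0 (gs ! e) (H c e)) \<and>
    (\<forall>v. v 0 \<in> M \<longleftrightarrow> (\<exists>w. \<forall>c<1. v c = (\<Sum>e<length gs. H c e * w e))) \<and>
    (\<forall>w. (\<forall>c<1. (\<Sum>e<length gs. H c e * w e) = 0) \<longrightarrow> (\<forall>e<length gs. \<not> w e dvd (1 :: ('n, 'a) mpoly)))"
    by (rule minimal_generators[OF finE, of "\<lambda>e. e" _ "\<lambda>c. 0" "\<lambda>e c. monomial e"])
      (auto simp: E(1,2) mem_ideal_of_monomials[OF finE] homogeneous_shift_def)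
  then obtain gs0 and H0 :: "nat \<Rightarrow> nat \<Rightarrow> ('n, 'a) mpoly" where *:
      "\<forall>d\<in>set gs0. squarefree_expvec d"
      "\<forall>c<1::nat. \<forall>e<length gs0. homogeneous_shift 0 (gs0 ! e) (H0 c e)"
      "\<forall>v. v (0::nat) \<in> M \<longleftrightarrow> (\<exists>w. \<forall>c<1. v c = (\<Sum>e<length gs0. H0 c e * w e))"
      "\<forall>w. (\<forall>c<1::nat. (\<Sum>e<length gs0. H0 c e * w e) = 0) \<longrightarrow> (\<forall>e<length gs0. \<not> w e dvd 1)"
    by (elim exE conjE) (rule that)
  have H0: "f \<in> M \<longleftrightarrow> (\<exists>w. f = (\<Sum>e<length gs0. H0 0 e * w e))" for f
    using *(3)[rule_format, of "\<lambda>_. f"] by simp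
  \<comment> \<open>A state consists of row degrees, a matrix and column degrees. The clause on
    syzygies is what carries minimality over to the following matrix; the last clause is minimality
    of the present one.\<close>
  define good where "good = (\<lambda>(rs, D, cs). (\<forall>d\<in>set cs. squarefree_expvec d) \<and>
    (\<forall>c<length rs. \<forall>e<length cs. homogeneous_shift (rs ! c) (cs ! e) (D c e)) \<and>
    (\<forall>w. (\<forall>c<length rs. (\<Sum>e<length cs. D c e * w e) = 0) \<longrightarrow>
       (\<forall>e<length cs. \<not> w e dvd (1 :: ('n, 'a) mpoly))) \<and>
    (\<forall>c<length rs. \<forall>e<length cs. \<not> D c e dvd 1))"
  define next_step where "next_step = (\<lambda>(rs :: 'n expvec list, D, cs :: 'n expvec list) (rs', D', cs').
    rs' = cs \<and> (\<forall>v. (\<forall>r<length rs. (\<Sum>c<length cs. D r c * v c) = 0) \<longleftrightarrow>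
       (\<exists>w. \<forall>c<length cs. v c = (\<Sum>e<length (cs' :: 'n expvec list). D' c e * w e :: ('n, 'a) mpoly))))"
  have start: "good ([0], H0, gs0)"
  proof -
    have "\<not> H0 0 e dvd 1" if e: "e < length gs0" for e
    proof
      assume "H0 0 e dvd 1"
      then obtain x where "1 = H0 0 e * x" by (metis dvdE)
      then have "1 = (\<Sum>i<length gs0. H0 0 i * (if i = e then x else 0))"
        using sum_delta_times[OF e, of "H0 0" x] by simp
      then have "1 \<in> M" unfolding H0 by (rule exI[of _ "\<lambda>i. if i = e then x else 0"])
      with proper show False ..
    qed
    then show ?thesis using *(1,2,4) by (simp add: good_def)
  qed
  have ext: "\<exists>s'. good s' \<and> next_step s s'" if s: "good s" for s
  proof -
    obtain rs D cs where sD: "s = (rs, D, cs)" by (cases s)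
    obtain gs H where gs: "\<forall>d\<in>set gs. squarefree_expvec d"
      "\<forall>c<length cs. \<forall>e<length gs. homogeneous_shift (cs ! c) (gs ! e) (H c e)"
      "\<And>v. (\<forall>r<length rs. (\<Sum>c<length cs. D r c * v c) = 0) \<longleftrightarrow>
         (\<exists>w. \<forall>c<length cs. v c = (\<Sum>e<length gs. H c e * w e))"
      "\<forall>w. (\<forall>c<length cs. (\<Sum>e<length gs. H c e * w e) = 0) \<longrightarrow> (\<forall>e<length gs. \<not> w e dvd 1)"
      using minimal_kernel_generators[of "length rs" "length cs" "\<lambda>r. rs ! r" "\<lambda>c. cs ! c" D] s
      by (auto simp: good_def sD)
    have "\<not> H c e dvd 1" if "c < length cs" "e < length gs" for c e
    proof -
      \<comment> \<open>Column e of \<open>H\<close> is a syzygy of \<open>D\<close>, so the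
        invariant forbids unit entries in it.\<close>
      have "\<forall>r<length rs. (\<Sum>c<length cs. D r c * H c e) = 0"
        unfolding gs(3) using sum_delta_times[OF that(2), of "H _" 1]
        by (intro exI[of _ "\<lambda>i. if i = e then 1 else 0"]) simp
      then show ?thesis using s that(1) by (auto simp: good_def sD)
    qed
    then have "good (cs, H, gs)" using gs(1,2,4) by (simp add: good_def)
    moreover have "next_step s (cs, H, gs)" using gs(3) by (simp add: next_step_def sD)
    ultimately show ?thesis by blast
  qed
  have "\<exists>f. \<forall>n. (good (f n) \<and> (n = 0 \<longrightarrow> f n = ([0], H0, gs0))) \<and> next_step (f n) (f (Suc n))"
    by (rule dependent_nat_choice) (use start ext in auto)
  then obtain f where f: "\<And>n. good (f n)" "f 0 = ([0], H0, gs0)" "\<And>n. next_step (f n) (f (Suc n))"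
    by blast
  define F :: "('n, 'a) aug_complex" where "F = \<lparr>degs = (\<lambda>i. fst (f i)),
    diff = (\<lambda>i. mat (length (fst (f i))) (length (snd (snd (f i)))) (\<lambda>(r, c). fst (snd (f i)) r c)),
    aug = vec 1 (\<lambda>_. 1)\<rparr>"
  have cs: "snd (snd (f i)) = degs F (Suc i)" for i
    using f(3)[of i] by (simp add: F_def next_step_def split: prod.splits)
  define D where "D i = fst (snd (f i))" for i
  have fi: "f i = (degs F i, D i, degs F (Suc i))" for i
    using cs[of i] by (simp add: F_def D_def prod_eq_iff)
  have deg0: "degs F 0 = [0]" using f(2) by (simp add: F_def)
  have diff: "diff F i = mat (free_rank F i) (free_rank F (Suc i)) (\<lambda>(r, c). D i r c)" for i
    using cs[of i] by (simp add: F_def free_rank_def D_def)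
  have rank0: "free_rank F 0 = 1" by (simp add: free_rank_def deg0)
  have good: "homogeneous_shift (degs F i ! r) (degs F (Suc i) ! c) (D i r c)" "\<not> D i r c dvd 1"
    if "r < free_rank F i" "c < free_rank F (Suc i)" for i r c
    using f(1)[of i] that by (auto simp: fi good_def free_rank_def)
  have aug: "aug F = vec 1 (\<lambda>_. 1)" by (simp add: F_def)
  have mg: "multigraded F"
    unfolding multigraded_def
    using good by (auto simp: diff aug free_mod_def rank0 deg0 homogeneous_shift_def[of 0])
  have M_eq: "M = {f. keys f \<subseteq> multiples E}" using E(2) by (simp add: ideal_of_monomials)
  have D0: "D 0 = H0" "free_rank F (Suc 0) = length gs0"
    using f(2) cs[of 0] by (simp_all add: D_def free_rank_def)
  have "free_resolution M F"
    unfolding free_resolution_iff[OF mg M_eq]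
  proof (intro conjI allI)
    fix g show "\<exists>v. keys ((\<Sum>c<free_rank F 0. aug F $ c * v c) - g) \<subseteq> multiples E"
      by (intro exI[of _ "\<lambda>_. g"]) (simp add: rank0 aug)
  next
    fix v :: "nat \<Rightarrow> ('n, 'a) mpoly"
    have "keys (v 0) \<subseteq> multiples E \<longleftrightarrow> v 0 \<in> M" by (simp add: M_eq)
    then show "keys (\<Sum>c<free_rank F 0. aug F $ c * v c) \<subseteq> multiples E \<longleftrightarrow>
       (\<exists>w. \<forall>c<free_rank F 0. v c = (\<Sum>e<free_rank F (Suc 0). diff F 0 $$ (c, e) * w e))"
      by (simp add: rank0 aug diff D0 H0)
  next
    fix i v
    show "(\<forall>r<free_rank F i. (\<Sum>c<free_rank F (Suc i). diff F i $$ (r, c) * v c) = 0) \<longleftrightarrow>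
       (\<exists>w. \<forall>c<free_rank F (Suc i). v c = (\<Sum>e<free_rank F (Suc (Suc i)). diff F (Suc i) $$ (c, e) * w e))"
      using f(3)[of i] by (simp add: fi next_step_def diff free_rank_def)
  qed
  then have "minimal_free_resolution M F"
    using good by (auto simp: minimal_free_resolution_def diff)
  then show ?thesis ..
qed

theorem theorem3p1:
  fixes M :: "('n::finite, 'a::field) mpoly set"
    and m :: "nat \<Rightarrow> 'n expvec"
    and q k :: nat
  assumes "q \<ge> 1"
    and "squarefree_monomial_ideal M"
    and "M = ideal_of (monomial ` m ` {1..q})"
    and "\<forall>i\<in>{1..q}. total_degree (m i) > k"
  shows "proj_dim M \<le> enat (CARD('n) - k)"
proof -
  obtain E where E: "\<And>e. e \<in> E \<Longrightarrow> squarefree_expvec e" "M = ideal_of (monomial ` E)"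
    using assms(2) by (auto simp: squarefree_monomial_ideal_def)
  have M: "M = {f. keys f \<subseteq> multiples E}" using E(2) by (simp add: ideal_of_monomials)
  have M': "M = {f. keys f \<subseteq> multiples (m ` {1..q})}" using assms(3) by (simp add: ideal_of_monomials)
  \<comment> \<open>Squarefreeness is known for \<open>E\<close> and the degree bound for the
    \<open>m i\<close>, possibly different generators. The bound passes to all monomials of M, as
    each is a multiple of some \<open>m i\<close>.\<close>
  have deg: "total_degree u > k" if "u \<in> multiples E" for u
  proof -
    have "monomial u \<in> M" using that by (simp add: M monomial_def)
    then have "u \<in> multiples (m ` {1..q})" by (simp add: M' monomial_def)
    then show ?thesis using assms(4) by (force simp: multiples_def total_degree_add)
  qed
  have U: "sqfree_exponents (multiples E) k" using E(1) deg by (rule sqfree_exponents_multiples)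
  \<comment> \<open>The exponent of 1 has degree 0, which does not exceed k.\<close>
  have "1 \<notin> M" using deg[of 0] by (auto simp: M total_degree_def)
  from someI_ex[OF minimal_free_resolution_exists[OF assms(2) this]]
  have "minimal_free_resolution M (SOME F. minimal_free_resolution M F)" .
  from minimal_free_resolution_rank[OF this M U]
  have "betti M i = 0" if "CARD('n) - k < i" for i using that by (simp add: betti_def)
  then show ?thesis unfolding proj_dim_def by (intro Sup_least) (auto simp: not_less[symmetric])
qed

end
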